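(* There exist infinitely many bipartite NIC-planar graphs $G$ such that, with $n$ denoting the number of vertices of $G$, $G$ has exactly $2.5n-5$ edges.
   Context: A topological drawing places vertices at distinct points and edges as Jordan arcs between their endpoints, such that no edge passes through a vertex other than its endpoints, no two adjacent edges cross, no edge crosses itself, no two edges meet tangentially, and any two edges cross at most once. A graph is NIC-planar if it admits such a drawing in which every edge is crossed at most once and crossings are nearly independent, i.e., no two crossing pairs of edges share two (or more) endpoints. *)

theory Defs
  imports "HOL-Analysis.Analysis"
begin

definition simple_graph :: "'a set \<Rightarrow> 'a set set \<Rightarrow> bool" where
  "simple_graph V E \<longleftrightarrow> finite V \<and> (\<forall>e\<in>E. e \<subseteq> V \<and> card e = 2)"

definition bipartite :: "'a set \<Rightarrow> 'a set set \<Rightarrow> bool" where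
  "bipartite V E \<longleftrightarrow>
     (\<exists>A B. A \<union> B = V \<and> A \<inter> B = {} \<and> (\<forall>e\<in>E. \<exists>a\<in>A. \<exists>b\<in>B. e = {a, b}))"

definition graph_iso :: "'a set \<times> 'a set set \<Rightarrow> 'b set \<times> 'b set set \<Rightarrow> bool" where
  "graph_iso G H \<longleftrightarrow>
     (\<exists>f. bij_betw f (fst G) (fst H) \<and>
          (\<forall>u\<in>fst G. \<forall>v\<in>fst G. {u, v} \<in> snd G \<longleftrightarrow> {f u, f v} \<in> snd H))"

text \<open>
  A (topologically transversal) crossing of two curves at a common inner point \<open>p\<close>: near \<open>p\<close>, up to a
  homeomorphism onto the open unit disk, the curves look like the two coordinate axes.
\<close>

definition cross_at :: "(real \<Rightarrow> complex) \<Rightarrow> (real \<Rightarrow> complex) \<Rightarrow> complex \<Rightarrow> bool" where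
  "cross_at g h p \<longleftrightarrow>
     p \<notin> {pathstart g, pathfinish g, pathstart h, pathfinish h} \<and>
     (\<exists>U \<phi> \<psi>. open U \<and> p \<in> U \<and> homeomorphism U (ball 0 1) \<phi> \<psi> \<and> \<phi> p = (0::complex) \<and>
        \<phi> ` (path_image g \<inter> U) = {z \<in> ball 0 1. Im z = 0} \<and>
        \<phi> ` (path_image h \<inter> U) = {z \<in> ball 0 1. Re z = 0})"

text \<open>
  \<open>pos\<close> places the vertices and \<open>\<gamma> e\<close> is the curve drawn for the edge \<open>e\<close>; its
  orientation is irrelevant. That no edge crosses itself is part of \<open>arc\<close> (injectivity).
  The absence of tangencies is the clause saying that two distinct edges cross
  at each common point other than the position of a common endpoint; it also rules out
  partially overlapping edges.
\<close>

definition topological_drawing ::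
  "'a set \<Rightarrow> 'a set set \<Rightarrow> ('a \<Rightarrow> complex) \<Rightarrow> ('a set \<Rightarrow> real \<Rightarrow> complex) \<Rightarrow> bool" where
  "topological_drawing V E pos \<gamma> \<longleftrightarrow>
     inj_on pos V \<and>
     (\<forall>e\<in>E. arc (\<gamma> e) \<and> {pathstart (\<gamma> e), pathfinish (\<gamma> e)} = pos ` e) \<and>
     (\<forall>e\<in>E. \<forall>v\<in>V. pos v \<in> path_image (\<gamma> e) \<longrightarrow> v \<in> e) \<and>
     (\<forall>e\<in>E. \<forall>f\<in>E. e \<noteq> f \<and> e \<inter> f \<noteq> {} \<longrightarrow> (\<nexists>p. cross_at (\<gamma> e) (\<gamma> f) p)) \<and>
     (\<forall>e\<in>E. \<forall>f\<in>E. e \<noteq> f \<longrightarrow>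
        (\<forall>p \<in> path_image (\<gamma> e) \<inter> path_image (\<gamma> f) - pos ` (e \<inter> f). cross_at (\<gamma> e) (\<gamma> f) p)) \<and>
     (\<forall>e\<in>E. \<forall>f\<in>E. e \<noteq> f \<longrightarrow>
        (\<forall>p q. cross_at (\<gamma> e) (\<gamma> f) p \<and> cross_at (\<gamma> e) (\<gamma> f) q \<longrightarrow> p = q))"

definition crossing_pair ::
  "'a set set \<Rightarrow> ('a set \<Rightarrow> real \<Rightarrow> complex) \<Rightarrow> 'a set \<Rightarrow> 'a set \<Rightarrow> bool" where
  "crossing_pair E \<gamma> e f \<longleftrightarrow> e \<in> E \<and> f \<in> E \<and> e \<noteq> f \<and> (\<exists>p. cross_at (\<gamma> e) (\<gamma> f) p)"

text \<open>
  In a topological drawing two edges cross at most once, so the number of crossings on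
  an edge is the number of edges crossing it.
\<close>

definition NIC_planar :: "'a set \<Rightarrow> 'a set set \<Rightarrow> bool" where
  "NIC_planar V E \<longleftrightarrow>
     (\<exists>pos \<gamma>. topological_drawing V E pos \<gamma> \<and>
        (\<forall>e f f'. crossing_pair E \<gamma> e f \<and> crossing_pair E \<gamma> e f' \<longrightarrow> f = f') \<and>
        (\<forall>e f e' f'. crossing_pair E \<gamma> e f \<and> crossing_pair E \<gamma> e' f' \<and> {e, f} \<noteq> {e', f'} \<longrightarrow>
           card ((e \<union> f) \<inter> (e' \<union> f')) < 2))"

end

theory Submission
  imports Defs
begin

text \<open>
  Take a plane bipartite graph with \<open>n\<close> vertices all of whose faces are hexagons; by Euler's formula it
  has \<open>(n - 2)/2\<close> faces and \<open>3(n - 2)/2\<close> edges. Drawing two of the three long diagonals in every face gives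
  \<open>5(n - 2)/2 = 2.5 n - 5\<close> edges, each face containing one crossing, and bipartiteness is kept. The
  endpoints of a crossing are four of the six vertices of a face and contain two opposite sides of it, so the
  diagonals have to be chosen such that no side is used from both of its faces.

  The hexangulations consist of nested 6-cycles. Consecutive cycles are joined by three edges, which
  gives rings of three hexagonal faces, and the innermost and the outermost cycle are capped by a
  vertex joined by three paths of length two to alternate vertices of the cycle. The crossings in a
  ring use one perfect matching of its outer cycle and one of its inner cycle, and the two perfect
  matchings used on a cycle from its two sides are complementary.

  All edges are straight. A 6-cycle is drawn as a triangle with three vertices on its sides, and the
  next ring is the image of the previous one under a contracting affine map, so only three concrete
  configurations with integer coordinates have to be examined.
\<close>

section \<open>Crossing segments\<close>

text \<open>Twice the signed area of the triangle \<open>a\<close>, \<open>b\<close>,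
  \<open>z\<close>; it is positive iff \<open>z\<close> lies to the left of the line from
  \<open>a\<close> to \<open>b\<close>.\<close>

definition orient :: "complex \<Rightarrow> complex \<Rightarrow> complex \<Rightarrow> real" where
  "orient a b z = (Re b - Re a) * (Im z - Im a) - (Im b - Im a) * (Re z - Re a)"

lemma orient_affine:
  "orient p q ((1 - t) *\<^sub>R a + t *\<^sub>R b) = (1 - t) * orient p q a + t * orient p q b"
  by (simp add: orient_def algebra_simps)

lemma orient_same [simp]: "orient a b a = 0" "orient a b b = 0"
  by (simp_all add: orient_def algebra_simps)

definition seg :: "complex \<times> complex \<Rightarrow> complex set" where
  "seg e = closed_segment (fst e) (snd e)"

definition ends :: "complex \<times> complex \<Rightarrow> complex set" where
  "ends e = {fst e, snd e}"

text \<open>The strict signs exclude touching and overlapping segments as well as common endpoints: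
  the segments cross at a point interior to both.\<close>

definition crosses :: "complex \<times> complex \<Rightarrow> complex \<times> complex \<Rightarrow> bool" where
  "crosses e f \<longleftrightarrow>
     orient (fst e) (snd e) (fst f) * orient (fst e) (snd e) (snd f) < 0 \<and>
     orient (fst f) (snd f) (fst e) * orient (fst f) (snd f) (snd e) < 0"

lemma crosses_commute: "crosses e f \<longleftrightarrow> crosses f e"
  by (auto simp: crosses_def)

lemma mem_segE:
  assumes "z \<in> seg e"
  obtains t where "0 \<le> t" "t \<le> 1" "z = (1 - t) *\<^sub>R fst e + t *\<^sub>R snd e"
  using assms by (auto simp: seg_def closed_segment_def)

text \<open>If the segments were parallel, both ends of \<open>f\<close> would have the same
  orientation with respect to \<open>e\<close>, and a square is not negative.\<close>

lemma crosses_orient_nonzero: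
  assumes "crosses e f"
  shows "(Re (snd e) - Re (fst e)) * (Im (snd f) - Im (fst f)) -
         (Im (snd e) - Im (fst e)) * (Re (snd f) - Re (fst f)) \<noteq> 0"
proof
  assume "(Re (snd e) - Re (fst e)) * (Im (snd f) - Im (fst f)) -
         (Im (snd e) - Im (fst e)) * (Re (snd f) - Re (fst f)) = 0"
  then have "orient (fst e) (snd e) (fst f) = orient (fst e) (snd e) (snd f)"
    by (simp add: orient_def algebra_simps)
  with assms show False
    unfolding crosses_def by (metis linorder_not_less zero_le_square)
qed

text \<open>\<open>x / (x - y)\<close> is the parameter at which an affine function with values
  \<open>x\<close> at 0 and \<open>y\<close> at 1 vanishes.\<close>

lemma opposite_signs_ratio:
  fixes x y :: real
  assumes "x * y < 0"
  shows "0 < x / (x - y)" "x / (x - y) < 1" "x - y \<noteq> 0"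
proof -
  have "x \<noteq> y" using assms by (metis linorder_not_less zero_le_square)
  then show "x - y \<noteq> 0" by simp
  show "0 < x / (x - y)" "x / (x - y) < 1"
    using assms by (auto simp: mult_less_0_iff divide_simps)
qed

text \<open>Cramer's rule for the two lines.\<close>

lemma crosses_point:
  assumes "crosses e f"
  obtains p s t where "0 < s" "s < 1" "p = (1 - s) *\<^sub>R fst e + s *\<^sub>R snd e"
    "0 < t" "t < 1" "p = (1 - t) *\<^sub>R fst f + t *\<^sub>R snd f"
proof -
  obtain a b c d where ef: "e = (a, b)" "f = (c, d)"
    by (cases e, cases f) auto
  \<comment> \<open>\<open>s\<close> is the zero of \<open>orient c d\<close> on the way from
    \<open>a\<close> to \<open>b\<close>, and \<open>t\<close> that of \<open>orient a b\<close>
    from \<open>c\<close> to \<open>d\<close>; up to sign both have the denominator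
    \<open>D\<close>.\<close>
  define s where "s = orient c d a / (orient c d a - orient c d b)"
  define t where "t = orient a b c / (orient a b c - orient a b d)"
  define D where "D = (Re b - Re a) * (Im d - Im c) - (Im b - Im a) * (Re d - Re c)"
  have cr: "orient a b c * orient a b d < 0" "orient c d a * orient c d b < 0"
    using assms by (auto simp: crosses_def ef)
  have D: "D \<noteq> 0"
    using crosses_orient_nonzero[OF assms] by (simp add: ef D_def)
  have D1: "orient c d a - orient c d b = D" and D2: "orient a b c - orient a b d = - D"
    by (simp_all add: orient_def D_def algebra_simps)
  have sD: "s * D = orient c d a" and tD: "t * D = - orient a b c"
    unfolding s_def t_def D1 D2 using D by auto
  have "D * Re ((1 - s) *\<^sub>R a + s *\<^sub>R b) = D * Re ((1 - t) *\<^sub>R c + t *\<^sub>R d)"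
  proof -
    have "D * Re ((1 - s) *\<^sub>R a + s *\<^sub>R b) = D * Re a + (s * D) * (Re b - Re a)"
      by (simp add: algebra_simps)
    also have "\<dots> = D * Re c + (t * D) * (Re d - Re c)"
      unfolding sD tD by (simp add: D_def orient_def algebra_simps)
    finally show ?thesis by (simp add: algebra_simps)
  qed
  moreover have "D * Im ((1 - s) *\<^sub>R a + s *\<^sub>R b) = D * Im ((1 - t) *\<^sub>R c + t *\<^sub>R d)"
  proof -
    have "D * Im ((1 - s) *\<^sub>R a + s *\<^sub>R b) = D * Im a + (s * D) * (Im b - Im a)"
      by (simp add: algebra_simps)
    also have "\<dots> = D * Im c + (t * D) * (Im d - Im c)"
      unfolding sD tD by (simp add: D_def orient_def algebra_simps)
    finally show ?thesis by (simp add: algebra_simps)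
  qed
  ultimately have "(1 - s) *\<^sub>R a + s *\<^sub>R b = (1 - t) *\<^sub>R c + t *\<^sub>R d"
    using D by (simp add: complex_eq_iff)
  then show ?thesis
    using that[of s "(1 - s) *\<^sub>R a + s *\<^sub>R b" t]
      opposite_signs_ratio[OF cr(1)] opposite_signs_ratio[OF cr(2)]
    by (auto simp: ef s_def t_def)
qed

text \<open>Along \<open>f\<close> the function \<open>orient (fst e) (snd e)\<close> is affine with
  opposite signs at the ends, hence injective, and it vanishes at every common point.\<close>

lemma crosses_seg_unique:
  assumes "crosses e f" "p \<in> seg e \<inter> seg f" "q \<in> seg e \<inter> seg f"
  shows "p = q"
proof -
  obtain s where s: "p = (1 - s) *\<^sub>R fst f + s *\<^sub>R snd f"
    using assms(2) by (auto elim: mem_segE)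
  obtain t where t: "q = (1 - t) *\<^sub>R fst f + t *\<^sub>R snd f"
    using assms(3) by (auto elim: mem_segE)
  let ?o = "orient (fst e) (snd e)"
  have z: "?o z = 0" if "z \<in> seg e" for z
    using that by (auto elim!: mem_segE simp: orient_affine)
  have "(1 - s) * ?o (fst f) + s * ?o (snd f) = 0" "(1 - t) * ?o (fst f) + t * ?o (snd f) = 0"
    using z assms(2,3) s t by (metis IntD1 orient_affine)+
  then have "(s - t) * (?o (fst f) - ?o (snd f)) = 0"
    by (simp add: algebra_simps)
  moreover have "?o (fst f) - ?o (snd f) \<noteq> 0"
    using assms(1) opposite_signs_ratio(3) by (auto simp: crosses_def)
  ultimately show ?thesis using s t by simp
qed

lemma crosses_point_notin_ends:
  assumes "crosses e f" "p \<in> seg e \<inter> seg f"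
  shows "p \<notin> ends e \<union> ends f"
proof -
  have z: "orient (fst e) (snd e) z = 0" if "z \<in> seg e" for z e
    using that by (auto elim!: mem_segE simp: orient_affine)
  show ?thesis
    using z[of p e] z[of p f] assms by (auto simp: crosses_def ends_def)
qed

lemma crosses_imp_ends_disjoint:
  assumes "crosses e f"
  shows "ends e \<inter> ends f = {}"
  using assms by (auto simp: crosses_def ends_def)

text \<open>Affine coordinates with origin \<open>p\<close> and axes along the two segments,
  suitably rescaled, give the homeomorphism onto the disk.\<close>

lemma crosses_cross_at:
  assumes "crosses e f" "p \<in> seg e \<inter> seg f"
  shows "cross_at (linepath (fst e) (snd e)) (linepath (fst f) (snd f)) p"
proof -
  obtain a b c d where ef: "e = (a, b)" "f = (c, d)"
    by (cases e, cases f) auto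
  obtain s t where st: "0 < s" "s < 1" "p = (1 - s) *\<^sub>R a + s *\<^sub>R b"
    "0 < t" "t < 1" "p = (1 - t) *\<^sub>R c + t *\<^sub>R d"
  proof -
    obtain p' s t where *: "0 < s" "s < 1" "p' = (1 - s) *\<^sub>R fst e + s *\<^sub>R snd e"
      "0 < t" "t < 1" "p' = (1 - t) *\<^sub>R fst f + t *\<^sub>R snd f"
      using crosses_point[OF assms(1)] by metis
    have "p' \<in> seg e"
      using * by (auto simp: seg_def closed_segment_def intro!: exI[of _ s])
    moreover have "p' \<in> seg f"
      using * by (auto simp: seg_def closed_segment_def intro!: exI[of _ t])
    ultimately have "p' = p"
      using crosses_seg_unique[OF assms(1)] assms(2) by auto
    with * show thesis
      by (intro that[of s t]) (simp_all add: ef)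
  qed
  define u where "u = b - a"
  define v where "v = d - c"
  define D where "D = Re u * Im v - Im u * Re v"
  \<comment> \<open>The smallest parameter distance from \<open>p\<close> to an endpoint: after
    scaling by \<epsilon> both axes of the disk stay within the segments.\<close>
  define \<epsilon> where "\<epsilon> = min (min s (1 - s)) (min t (1 - t))"
  have \<epsilon>: "0 < \<epsilon>" "\<epsilon> \<le> s" "\<epsilon> \<le> 1 - s" "\<epsilon> \<le> t" "\<epsilon> \<le> 1 - t"
    using st by (auto simp: \<epsilon>_def)
  have D: "D \<noteq> 0"
    using crosses_orient_nonzero[OF assms(1)] by (simp add: D_def u_def v_def ef)
  \<comment> \<open>\<psi> sends the axes to the two lines through \<open>p\<close>; \<phi> is its
    inverse by Cramer's rule.\<close>
  define \<psi> where "\<psi> w = p + (\<epsilon> * Re w) *\<^sub>R u + (\<epsilon> * Im w) *\<^sub>R v" for w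
  define \<phi> where "\<phi> z = Complex ((Re (z - p) * Im v - Im (z - p) * Re v) / (\<epsilon> * D))
                               ((Re u * Im (z - p) - Im u * Re (z - p)) / (\<epsilon> * D))" for z
  have \<epsilon>D: "\<epsilon> * D \<noteq> 0" using \<epsilon> D by simp
  have \<phi>\<psi>: "\<phi> (\<psi> w) = w" for w
  proof -
    have "Re (\<psi> w - p) * Im v - Im (\<psi> w - p) * Re v = Re w * (\<epsilon> * D)"
      "Re u * Im (\<psi> w - p) - Im u * Re (\<psi> w - p) = Im w * (\<epsilon> * D)"
      by (simp_all add: \<psi>_def D_def algebra_simps)
    then show ?thesis using \<epsilon>D by (simp add: \<phi>_def complex_eq_iff)
  qed
  have \<psi>\<phi>: "\<psi> (\<phi> z) = z" for z
  proof -
    have 1: "\<epsilon> * Re (\<phi> z) = (Re (z - p) * Im v - Im (z - p) * Re v) / D"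
      "\<epsilon> * Im (\<phi> z) = (Re u * Im (z - p) - Im u * Re (z - p)) / D"
      using \<epsilon> D by (simp_all add: \<phi>_def)
    have "D * Re (\<psi> (\<phi> z)) = D * Re z" "D * Im (\<psi> (\<phi> z)) = D * Im z"
      unfolding \<psi>_def 1 using D
      by (simp_all add: distrib_left) (simp_all add: D_def algebra_simps)
    then show ?thesis using D by (simp add: complex_eq_iff)
  qed
  have cont\<phi>: "continuous_on S \<phi>" for S
    unfolding \<phi>_def Complex_eq using \<epsilon>D by (intro continuous_intros) auto
  have cont\<psi>: "continuous_on S \<psi>" for S
    unfolding \<psi>_def by (intro continuous_intros)
  define U where "U = \<phi> -` ball 0 1"
  have openU: "open U"
    unfolding U_def using cont\<phi>[of UNIV] by (simp add: open_vimage)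
  have "homeomorphism U (ball 0 1) \<phi> \<psi>"
    by (rule homeomorphismI) (auto simp: U_def \<phi>\<psi> \<psi>\<phi> cont\<phi> cont\<psi>)
  moreover have "\<phi> p = 0"
    by (simp add: \<phi>_def complex_eq_iff)
  moreover have "\<phi> ` (path_image (linepath a b) \<inter> U) = {z \<in> ball 0 1. Im z = 0}"
  proof (intro equalityI subsetI)
    fix w assume "w \<in> \<phi> ` (path_image (linepath a b) \<inter> U)"
    then obtain z where z: "w = \<phi> z" "z \<in> closed_segment a b" "\<phi> z \<in> ball 0 1"
      by (auto simp: U_def)
    then obtain r where "z = (1 - r) *\<^sub>R a + r *\<^sub>R b"
      by (auto simp: closed_segment_def)
    then have "z - p = (r - s) *\<^sub>R u"
      unfolding st(3) by (simp add: u_def algebra_simps)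
    then have "Im (\<phi> z) = 0" unfolding \<phi>_def by simp
    with z show "w \<in> {z \<in> ball 0 1. Im z = 0}" by auto
  next
    fix w :: complex assume w: "w \<in> {z \<in> ball 0 1. Im z = 0}"
    then have "\<bar>Re w\<bar> \<le> 1" using abs_Re_le_cmod[of w] by auto
    then have "\<bar>\<epsilon> * Re w\<bar> \<le> \<epsilon> * 1" using \<epsilon>(1) by (simp add: abs_mult)
    moreover have "\<psi> w = (1 - (s + \<epsilon> * Re w)) *\<^sub>R a + (s + \<epsilon> * Re w) *\<^sub>R b"
      using w unfolding \<psi>_def st(3) by (simp add: u_def algebra_simps)
    ultimately have "\<psi> w \<in> path_image (linepath a b)"
      using \<epsilon> by (auto simp: closed_segment_def intro!: exI[of _ "s + \<epsilon> * Re w"])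
    moreover have "\<psi> w \<in> U" using w by (simp add: U_def \<phi>\<psi>)
    ultimately show "w \<in> \<phi> ` (path_image (linepath a b) \<inter> U)"
      using \<phi>\<psi> by (metis IntI image_eqI)
  qed
  moreover have "\<phi> ` (path_image (linepath c d) \<inter> U) = {z \<in> ball 0 1. Re z = 0}"
  proof (intro equalityI subsetI)
    fix w assume "w \<in> \<phi> ` (path_image (linepath c d) \<inter> U)"
    then obtain z where z: "w = \<phi> z" "z \<in> closed_segment c d" "\<phi> z \<in> ball 0 1"
      by (auto simp: U_def)
    then obtain r where "z = (1 - r) *\<^sub>R c + r *\<^sub>R d"
      by (auto simp: closed_segment_def)
    then have "z - p = (r - t) *\<^sub>R v"
      unfolding st(6) by (simp add: v_def algebra_simps)
    then have "Re (\<phi> z) = 0" unfolding \<phi>_def by simp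
    with z show "w \<in> {z \<in> ball 0 1. Re z = 0}" by auto
  next
    fix w :: complex assume w: "w \<in> {z \<in> ball 0 1. Re z = 0}"
    then have "\<bar>Im w\<bar> \<le> 1" using abs_Im_le_cmod[of w] by auto
    then have "\<bar>\<epsilon> * Im w\<bar> \<le> \<epsilon> * 1" using \<epsilon>(1) by (simp add: abs_mult)
    moreover have "\<psi> w = (1 - (t + \<epsilon> * Im w)) *\<^sub>R c + (t + \<epsilon> * Im w) *\<^sub>R d"
      using w unfolding \<psi>_def st(6) by (simp add: v_def algebra_simps)
    ultimately have "\<psi> w \<in> path_image (linepath c d)"
      using \<epsilon> by (auto simp: closed_segment_def intro!: exI[of _ "t + \<epsilon> * Im w"])
    moreover have "\<psi> w \<in> U" using w by (simp add: U_def \<phi>\<psi>)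
    ultimately show "w \<in> \<phi> ` (path_image (linepath c d) \<inter> U)"
      using \<phi>\<psi> by (metis IntI image_eqI)
  qed
  moreover have "p \<in> U" using \<open>\<phi> p = 0\<close> by (simp add: U_def)
  moreover have "p \<notin> {a, b, c, d}"
    using crosses_point_notin_ends[OF assms] by (simp add: ends_def ef)
  ultimately show ?thesis
    unfolding cross_at_def using openU by (auto simp: ef)
qed

text \<open>The centre of the disk lies on both axes, and \<open>p\<close> is its only preimage in
  \<open>U\<close>.\<close>

lemma cross_at_imp_mem:
  assumes "cross_at g h p"
  shows "p \<in> path_image g" "p \<in> path_image h"
    "p \<notin> {pathstart g, pathfinish g, pathstart h, pathfinish h}"
proof -
  from assms obtain U \<phi> \<psi> where U: "open U" "p \<in> U" "homeomorphism U (ball 0 1) \<phi> \<psi>"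
    "\<phi> p = (0::complex)" "\<phi> ` (path_image g \<inter> U) = {z \<in> ball 0 1. Im z = 0}"
    "\<phi> ` (path_image h \<inter> U) = {z \<in> ball 0 1. Re z = 0}"
    unfolding cross_at_def by blast
  have inj: "x = p" if "x \<in> U" "\<phi> x = 0" for x
    using that U(2-4) unfolding homeomorphism_def by metis
  have "0 \<in> \<phi> ` (path_image g \<inter> U)" "0 \<in> \<phi> ` (path_image h \<inter> U)"
    unfolding U by auto
  then show "p \<in> path_image g" "p \<in> path_image h"
    using inj by (metis IntE imageE)+
  show "p \<notin> {pathstart g, pathfinish g, pathstart h, pathfinish h}"
    using assms by (auto simp: cross_at_def)
qed

section \<open>Straight-line drawings\<close>

definition verts :: "(complex \<times> complex) set \<Rightarrow> complex set" where
  "verts E = fst ` E \<union> snd ` E"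

text \<open>
  An edge is a pair whose first component belongs to one colour class and whose second component
  belongs to the other, so that a bipartite graph without isolated vertices is just a set of pairs.
\<close>

definition nic_segments :: "(complex \<times> complex) set \<Rightarrow> bool" where
  "nic_segments E \<longleftrightarrow>
     finite E \<and> fst ` E \<inter> snd ` E = {} \<and>
     (\<forall>e\<in>E. seg e \<inter> verts E \<subseteq> ends e) \<and>
     (\<forall>e\<in>E. \<forall>f\<in>E. e \<noteq> f \<longrightarrow> seg e \<inter> seg f \<subseteq> ends e \<inter> ends f \<or> crosses e f) \<and>
     (\<forall>e\<in>E. \<forall>f\<in>E. \<forall>e'\<in>E. \<forall>f'\<in>E.
        crosses e f \<and> crosses e' f' \<and> {e, f} \<noteq> {e', f'} \<longrightarrow>
        card ((ends e \<union> ends f) \<inter> (ends e' \<union> ends f')) < 2)"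

lemma ends_subset_verts: "e \<in> E \<Longrightarrow> ends e \<subseteq> verts E"
  by (auto simp: ends_def verts_def)

lemma nic_segments_Int:
  assumes "nic_segments E" "e \<in> E" "f \<in> E" "e \<noteq> f"
  shows "seg e \<inter> seg f \<subseteq> ends e \<inter> ends f \<or> crosses e f"
  using assms by (simp add: nic_segments_def)

lemma nic_segments_quads:
  assumes "nic_segments E" "e \<in> E" "f \<in> E" "e' \<in> E" "f' \<in> E"
    "crosses e f" "crosses e' f'" "{e, f} \<noteq> {e', f'}"
  shows "card ((ends e \<union> ends f) \<inter> (ends e' \<union> ends f')) < 2"
  using assms by (simp add: nic_segments_def)

lemma crosses_obtain_point:
  assumes "crosses e f"
  obtains p where "p \<in> seg e" "p \<in> seg f" "p \<notin> ends e" "p \<notin> ends f"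
proof -
  obtain p s t where *: "0 < s" "s < 1" "p = (1 - s) *\<^sub>R fst e + s *\<^sub>R snd e"
    "0 < t" "t < 1" "p = (1 - t) *\<^sub>R fst f + t *\<^sub>R snd f"
    using crosses_point[OF assms] by metis
  have "p \<in> seg e"
    using * by (auto simp: seg_def closed_segment_def intro!: exI[of _ s])
  moreover have "p \<in> seg f"
    using * by (auto simp: seg_def closed_segment_def intro!: exI[of _ t])
  ultimately show ?thesis
    using that crosses_point_notin_ends[OF assms] by blast
qed

lemma crosses_not_seg_subset_ends:
  assumes "crosses e f"
  shows "\<not> seg e \<inter> seg f \<subseteq> ends e"
  using crosses_obtain_point[OF assms] by blast

text \<open>The colour classes are disjoint, so \<open>(a, b)\<close> and \<open>(b, a)\<close>
  never both belong to \<open>E\<close> and an unordered edge determines its pair.\<close>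

lemma inj_on_ends:
  assumes "nic_segments E" "inj_on h (verts E)"
  shows "inj_on (\<lambda>e. h ` ends e) E"
proof (rule inj_onI)
  fix e f assume ef: "e \<in> E" "f \<in> E" "h ` ends e = h ` ends f"
  then have "ends e = ends f"
    using inj_on_image_eq_iff[OF assms(2)] ends_subset_verts by metis
  moreover have "fst ` E \<inter> snd ` E = {}"
    using assms by (simp add: nic_segments_def)
  ultimately show "e = f"
    using ef unfolding ends_def
    by (metis IntI doubleton_eq_iff empty_iff image_eqI prod_eq_iff)
qed

text \<open>The passage from segments to an abstract graph: \<open>h\<close> renames the vertices,
  \<open>pos\<close> undoes the renaming, and every edge is drawn as its segment.\<close>

lemma nic_segments_graph:
  fixes h :: "complex \<Rightarrow> 'a"
  assumes nic: "nic_segments E" and inj: "inj_on h (verts E)"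
  defines "V \<equiv> h ` verts E" and "F \<equiv> (\<lambda>e. h ` ends e) ` E"
  shows "simple_graph V F" "bipartite V F" "NIC_planar V F"
    "card V = card (verts E)" "card F = card E"
proof -
  have fin: "finite E" and col: "fst ` E \<inter> snd ` E = {}"
    using nic by (auto simp: nic_segments_def)
  have ne: "fst e \<noteq> snd e" if "e \<in> E" for e
    using col that by (metis IntI empty_iff image_eqI)
  show "card V = card (verts E)"
    unfolding V_def using inj by (rule card_image)
  show "card F = card E"
    unfolding F_def using inj_on_ends[OF nic inj] by (rule card_image)
  show "simple_graph V F"
    unfolding simple_graph_def
  proof (intro conjI ballI)
    show "finite V" using fin by (simp add: V_def verts_def)
    fix e' assume "e' \<in> F"
    then obtain e where e: "e \<in> E" "e' = h ` ends e" by (auto simp: F_def)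
    show "e' \<subseteq> V" unfolding e V_def using ends_subset_verts[OF e(1)] by (rule image_mono)
    have "card e' = card (ends e)"
      unfolding e using inj_on_subset[OF inj ends_subset_verts[OF e(1)]] by (rule card_image)
    then show "card e' = 2" using ne[OF e(1)] by (simp add: ends_def)
  qed
  show "bipartite V F"
    unfolding bipartite_def
  proof (intro exI conjI ballI)
    show "h ` fst ` E \<union> h ` snd ` E = V"
      by (simp add: V_def verts_def image_Un)
    have "h ` (fst ` E \<inter> snd ` E) = h ` fst ` E \<inter> h ` snd ` E"
      by (rule inj_on_image_Int[OF inj]) (auto simp: verts_def)
    then show "h ` fst ` E \<inter> h ` snd ` E = {}" using col by simp
    fix e' assume "e' \<in> F"
    then show "\<exists>a\<in>h ` fst ` E. \<exists>b\<in>h ` snd ` E. e' = {a, b}"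
      by (force simp: F_def ends_def)
  qed
  define pos where "pos = inv_into (verts E) h"
  define \<gamma> where "\<gamma> e' = (case inv_into E (\<lambda>e. h ` ends e) e' of (a, b) \<Rightarrow> linepath a b)" for e'
  have pos: "pos (h v) = v" if "v \<in> verts E" for v
    unfolding pos_def using inj that by simp
  have \<gamma>: "\<gamma> (h ` ends e) = linepath (fst e) (snd e)" if "e \<in> E" for e
    unfolding \<gamma>_def using inv_into_f_f[OF inj_on_ends[OF nic inj] that]
    by (simp add: case_prod_beta)
  have posV: "pos ` h ` A = A" if "A \<subseteq> verts E" for A
    using that pos by (force simp: image_image image_iff)
  have image_Int: "h ` A \<inter> h ` B = h ` (A \<inter> B)" if "A \<subseteq> verts E" "B \<subseteq> verts E" for A B
    using inj_on_image_Int[OF inj that] by simp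
  have pim: "path_image (\<gamma> (h ` ends e)) = seg e" if "e \<in> E" for e
    using \<gamma>[OF that] by (simp add: seg_def)
  have ps: "{pathstart (\<gamma> (h ` ends e)), pathfinish (\<gamma> (h ` ends e))} = ends e" if "e \<in> E" for e
    using \<gamma>[OF that] by (simp add: ends_def)
  have heq: "h ` ends e = h ` ends f \<longleftrightarrow> e = f" if "e \<in> E" "f \<in> E" for e f
    using inj_on_ends[OF nic inj] that by (auto dest: inj_onD)
  \<comment> \<open>A point of \<open>cross_at\<close> is never an endpoint, so the first
    alternative that \<open>nic_segments\<close> offers for two distinct edges fails.\<close>
  have cross_crosses: "crosses e f" "p \<in> seg e \<inter> seg f"
    if "e \<in> E" "f \<in> E" "e \<noteq> f" "cross_at (\<gamma> (h ` ends e)) (\<gamma> (h ` ends f)) p" for e f p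
  proof -
    have p: "p \<in> seg e" "p \<in> seg f" "p \<notin> ends e"
      using cross_at_imp_mem[OF that(4)] pim that(1,2) ps[OF that(1)] by auto
    then show "p \<in> seg e \<inter> seg f" by simp
    have "seg e \<inter> seg f \<subseteq> ends e \<inter> ends f \<or> crosses e f"
      using nic_segments_Int[OF nic] that(1-3) by simp
    with p show "crosses e f" by blast
  qed
  have cross_crossing: "crosses e f"
    if "e \<in> E" "f \<in> E" "crossing_pair F \<gamma> (h ` ends e) (h ` ends f)" for e f
    using that cross_crosses heq unfolding crossing_pair_def by metis
  have cpE: "\<exists>e\<in>E. \<exists>f\<in>E. e' = h ` ends e \<and> f' = h ` ends f \<and> crosses e f"
    if cp: "crossing_pair F \<gamma> e' f'" for e' f'
  proof -
    obtain e f where "e \<in> E" "f \<in> E" "e' = h ` ends e" "f' = h ` ends f"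
      using cp unfolding crossing_pair_def F_def by blast
    with cp cross_crossing show ?thesis by blast
  qed
  have "topological_drawing V F pos \<gamma>"
    unfolding topological_drawing_def
  proof (intro conjI)
    show "inj_on pos V"
      using pos by (auto simp: V_def intro!: inj_onI)
    show "\<forall>e\<in>F. arc (\<gamma> e) \<and> {pathstart (\<gamma> e), pathfinish (\<gamma> e)} = pos ` e"
      using \<gamma> ne ps posV[OF ends_subset_verts] by (auto simp: F_def)
    show "\<forall>e\<in>F. \<forall>v\<in>V. pos v \<in> path_image (\<gamma> e) \<longrightarrow> v \<in> e"
    proof (intro ballI impI)
      fix e' v' assume "e' \<in> F" "v' \<in> V" and im: "pos v' \<in> path_image (\<gamma> e')"
      then obtain e v where e: "e \<in> E" "e' = h ` ends e" and v: "v \<in> verts E" "v' = h v"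
        unfolding F_def V_def by blast
      have "v \<in> seg e" using im pim e v pos by simp
      then have "v \<in> ends e" using nic e(1) v(1) by (auto simp: nic_segments_def)
      then show "v' \<in> e'" using e v by simp
    qed
    show "\<forall>e\<in>F. \<forall>f\<in>F. e \<noteq> f \<and> e \<inter> f \<noteq> {} \<longrightarrow> (\<nexists>p. cross_at (\<gamma> e) (\<gamma> f) p)"
    proof (intro ballI impI notI)
      fix e' f' assume "e' \<in> F" "f' \<in> F" and *: "e' \<noteq> f' \<and> e' \<inter> f' \<noteq> {}"
        "\<exists>p. cross_at (\<gamma> e') (\<gamma> f') p"
      then obtain e f where ef: "e \<in> E" "e' = h ` ends e" "f \<in> E" "f' = h ` ends f"
        unfolding F_def by blast
      then have "crosses e f" using * cross_crosses(1) by metis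
      then have "ends e \<inter> ends f = {}" by (rule crosses_imp_ends_disjoint)
      moreover have "e' \<inter> f' = h ` (ends e \<inter> ends f)"
        using image_Int ef ends_subset_verts by simp
      ultimately show False using * by simp
    qed
    show "\<forall>e\<in>F. \<forall>f\<in>F. e \<noteq> f \<longrightarrow>
        (\<forall>p \<in> path_image (\<gamma> e) \<inter> path_image (\<gamma> f) - pos ` (e \<inter> f). cross_at (\<gamma> e) (\<gamma> f) p)"
    proof (intro ballI impI)
      fix e' f' p assume "e' \<in> F" "f' \<in> F" and *: "e' \<noteq> f'"
        "p \<in> path_image (\<gamma> e') \<inter> path_image (\<gamma> f') - pos ` (e' \<inter> f')"
      then obtain e f where ef: "e \<in> E" "e' = h ` ends e" "f \<in> E" "f' = h ` ends f"
        unfolding F_def by blast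
      have "e' \<inter> f' = h ` (ends e \<inter> ends f)"
        using image_Int ef ends_subset_verts by simp
      then have "pos ` (e' \<inter> f') = ends e \<inter> ends f"
        using posV ends_subset_verts ef by (metis inf.coboundedI1)
      then have p: "p \<in> seg e \<inter> seg f" "p \<notin> ends e \<inter> ends f"
        using * ef pim by auto
      have "seg e \<inter> seg f \<subseteq> ends e \<inter> ends f \<or> crosses e f"
        using nic_segments_Int[OF nic] ef * by metis
      with p have "crosses e f" by blast
      then show "cross_at (\<gamma> e') (\<gamma> f') p"
        using crosses_cross_at p(1) ef \<gamma> by simp
    qed
    show "\<forall>e\<in>F. \<forall>f\<in>F. e \<noteq> f \<longrightarrow>
        (\<forall>p q. cross_at (\<gamma> e) (\<gamma> f) p \<and> cross_at (\<gamma> e) (\<gamma> f) q \<longrightarrow> p = q)"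
      using cross_crosses crosses_seg_unique unfolding F_def by (smt (verit) imageE)
  qed
  \<comment> \<open>That an edge is crossed at most once follows from near independence: two
    crossing pairs containing \<open>e\<close> share both ends of \<open>e\<close>.\<close>
  moreover have "\<forall>e f f'. crossing_pair F \<gamma> e f \<and> crossing_pair F \<gamma> e f' \<longrightarrow> f = f'"
  proof (intro allI impI, elim conjE)
    fix e' f' f'' assume "crossing_pair F \<gamma> e' f'" "crossing_pair F \<gamma> e' f''"
    then obtain e f e1 f1 where *: "e \<in> E" "f \<in> E" "e' = h ` ends e" "f' = h ` ends f" "crosses e f"
      "e1 \<in> E" "f1 \<in> E" "e' = h ` ends e1" "f'' = h ` ends f1" "crosses e1 f1"
      using cpE by metis
    then have "e1 = e" using heq by metis
    have "f = f1"
    proof (rule ccontr)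
      assume "f \<noteq> f1"
      then have "{e, f} \<noteq> {e, f1}" by (simp add: doubleton_eq_iff)
      then have "card ((ends e \<union> ends f) \<inter> (ends e \<union> ends f1)) < 2"
        using nic_segments_quads[OF nic] * \<open>e1 = e\<close> by metis
      moreover have "card (ends e) \<le> card ((ends e \<union> ends f) \<inter> (ends e \<union> ends f1))"
        by (rule card_mono) (auto simp: ends_def)
      moreover have "card (ends e) = 2" using ne[OF *(1)] by (simp add: ends_def)
      ultimately show False by simp
    qed
    then show "f' = f''" using * by simp
  qed
  moreover have "\<forall>e f e' f'. crossing_pair F \<gamma> e f \<and> crossing_pair F \<gamma> e' f' \<and> {e, f} \<noteq> {e', f'} \<longrightarrow>
           card ((e \<union> f) \<inter> (e' \<union> f')) < 2"
  proof (intro allI impI, elim conjE)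
    fix e' f' e1' f1'
    assume "crossing_pair F \<gamma> e' f'" "crossing_pair F \<gamma> e1' f1'" and neq: "{e', f'} \<noteq> {e1', f1'}"
    then obtain e f e1 f1 where *: "e \<in> E" "f \<in> E" "e' = h ` ends e" "f' = h ` ends f" "crosses e f"
      "e1 \<in> E" "f1 \<in> E" "e1' = h ` ends e1" "f1' = h ` ends f1" "crosses e1 f1"
      using cpE by metis
    then have "{e, f} \<noteq> {e1, f1}" using neq by (auto simp: doubleton_eq_iff)
    then have lt: "card ((ends e \<union> ends f) \<inter> (ends e1 \<union> ends f1)) < 2"
      using nic_segments_quads[OF nic] * by metis
    have sub: "ends e \<union> ends f \<subseteq> verts E" "ends e1 \<union> ends f1 \<subseteq> verts E"
      using * ends_subset_verts by auto
    have "(e' \<union> f') \<inter> (e1' \<union> f1') = h ` ((ends e \<union> ends f) \<inter> (ends e1 \<union> ends f1))"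
      using image_Int[OF sub] * by (simp add: image_Un)
    then show "card ((e' \<union> f') \<inter> (e1' \<union> f1')) < 2"
      using lt card_image[OF inj_on_subset[OF inj]] sub by (metis inf.coboundedI1)
  qed
  ultimately show "NIC_planar V F"
    unfolding NIC_planar_def by blast
qed

section \<open>Gluing and affine images\<close>

text \<open>\<open>E2\<close> fills the convex set \<open>T\<close> and \<open>E1\<close> meets
  \<open>T\<close> only in vertices, so edges from different sides meet only in common ends and no
  new crossing arises. Near independence between the two sides is assumed as
  \<open>quads\<close>.\<close>

lemma nic_segments_Un:
  assumes nic1: "nic_segments E1" and nic2: "nic_segments E2"
    and T: "convex T" "verts E2 \<subseteq> T"
    and out: "\<And>e. e \<in> E1 \<Longrightarrow> seg e \<inter> T \<subseteq> ends e"
    and fst_T: "fst ` E1 \<inter> T \<subseteq> fst ` E2" and snd_T: "snd ` E1 \<inter> T \<subseteq> snd ` E2"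
    and quads: "\<And>e f e' f'. \<lbrakk>e \<in> E1; f \<in> E1; e' \<in> E2; f' \<in> E2; crosses e f; crosses e' f'\<rbrakk>
      \<Longrightarrow> card ((ends e \<union> ends f) \<inter> (ends e' \<union> ends f')) < 2"
  shows "nic_segments (E1 \<union> E2)" "E1 \<inter> E2 = {}"
    "\<And>e f. e \<in> E1 \<Longrightarrow> f \<in> E2 \<Longrightarrow> \<not> crosses e f"
proof -
  have seg_T: "seg e \<subseteq> T" if "e \<in> E2" for e
    unfolding seg_def using that T
    by (intro closed_segment_subset) (auto simp: verts_def)
  have verts_T: "verts E1 \<inter> T \<subseteq> verts E2"
    using fst_T snd_T by (auto simp: verts_def)
  have on2: "seg e \<inter> verts E2 \<subseteq> ends e" if "e \<in> E2" for e
    using nic2 that by (simp add: nic_segments_def)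
  \<comment> \<open>A common point lies in \<open>T\<close>, hence is an end of \<open>e\<close>; as
    a vertex of \<open>E1\<close> in \<open>T\<close> it is a vertex of \<open>E2\<close>, and such
    a vertex lies on \<open>f\<close> only as an end.\<close>
  have mixed: "seg e \<inter> seg f \<subseteq> ends e \<inter> ends f" if "e \<in> E1" "f \<in> E2" for e f
    using out[OF that(1)] seg_T[OF that(2)] on2[OF that(2)] verts_T
      ends_subset_verts[OF that(1)] by blast
  have not_cross: "\<not> crosses e f" "\<not> crosses f e" if "e \<in> E1" "f \<in> E2" for e f
    using mixed[OF that] crosses_not_seg_subset_ends crosses_commute by blast+
  then show "\<And>e f. e \<in> E1 \<Longrightarrow> f \<in> E2 \<Longrightarrow> \<not> crosses e f" by blast
  have ne: "fst e \<noteq> snd e" if "e \<in> E1" for e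
    using nic1 that unfolding nic_segments_def by (metis IntI empty_iff image_eqI)
  show "E1 \<inter> E2 = {}"
  proof (rule ccontr)
    assume "E1 \<inter> E2 \<noteq> {}"
    then obtain e where e: "e \<in> E1" "e \<in> E2" by blast
    then have "seg e \<subseteq> ends e" using mixed[OF e] by blast
    then have "midpoint (fst e) (snd e) \<in> ends e"
      by (auto simp: seg_def)
    then show False using ne[OF e(1)] by (simp add: ends_def)
  qed
  show "nic_segments (E1 \<union> E2)"
    unfolding nic_segments_def
  proof (intro conjI)
    show "finite (E1 \<union> E2)" using nic1 nic2 by (simp add: nic_segments_def)
    have "fst ` E2 \<subseteq> T" "snd ` E2 \<subseteq> T" using T by (auto simp: verts_def)
    moreover have "fst ` E1 \<inter> snd ` E1 = {}" "fst ` E2 \<inter> snd ` E2 = {}"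
      using nic1 nic2 by (auto simp: nic_segments_def)
    moreover have "(A1 \<union> A2) \<inter> (B1 \<union> B2) = {}"
      if "A1 \<inter> B1 = {}" "A2 \<inter> B2 = {}" "A1 \<inter> T \<subseteq> A2" "B1 \<inter> T \<subseteq> B2" "A2 \<subseteq> T" "B2 \<subseteq> T"
      for A1 A2 B1 B2 :: "complex set"
      using that by blast
    ultimately show "fst ` (E1 \<union> E2) \<inter> snd ` (E1 \<union> E2) = {}"
      using fst_T snd_T by (simp add: image_Un)
    have on1: "seg e \<inter> verts E1 \<subseteq> ends e" if "e \<in> E1" for e
      using nic1 that by (simp add: nic_segments_def)
    have "verts (E1 \<union> E2) = verts E1 \<union> verts E2" by (auto simp: verts_def)
    then show "\<forall>e\<in>E1 \<union> E2. seg e \<inter> verts (E1 \<union> E2) \<subseteq> ends e"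
      using on1 on2 out T(2) seg_T verts_T by blast
    show "\<forall>e\<in>E1 \<union> E2. \<forall>f\<in>E1 \<union> E2. e \<noteq> f \<longrightarrow>
        seg e \<inter> seg f \<subseteq> ends e \<inter> ends f \<or> crosses e f"
    proof (intro ballI impI)
      fix e f assume "e \<in> E1 \<union> E2" "f \<in> E1 \<union> E2" "e \<noteq> f"
      then consider "e \<in> E1" "f \<in> E1" | "e \<in> E2" "f \<in> E2" | "e \<in> E1" "f \<in> E2" | "e \<in> E2" "f \<in> E1"
        by blast
      then show "seg e \<inter> seg f \<subseteq> ends e \<inter> ends f \<or> crosses e f"
      proof cases
        case 1 then show ?thesis using nic_segments_Int[OF nic1] \<open>e \<noteq> f\<close> by simp
      next
        case 2 then show ?thesis using nic_segments_Int[OF nic2] \<open>e \<noteq> f\<close> by simp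
      next
        case 3 then show ?thesis using mixed by simp
      next
        case 4 then show ?thesis using mixed[of f e] by blast
      qed
    qed
    show "\<forall>e\<in>E1 \<union> E2. \<forall>f\<in>E1 \<union> E2. \<forall>e'\<in>E1 \<union> E2. \<forall>f'\<in>E1 \<union> E2.
        crosses e f \<and> crosses e' f' \<and> {e, f} \<noteq> {e', f'} \<longrightarrow>
        card ((ends e \<union> ends f) \<inter> (ends e' \<union> ends f')) < 2"
    proof (intro ballI impI, elim conjE)
      fix e f e' f'
      assume mem: "e \<in> E1 \<union> E2" "f \<in> E1 \<union> E2" "e' \<in> E1 \<union> E2" "f' \<in> E1 \<union> E2"
        and cr: "crosses e f" "crosses e' f'" and neq: "{e, f} \<noteq> {e', f'}"
      \<comment> \<open>Mixed pairs do not cross, so each crossing pair lies within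
        \<open>E1\<close> or within \<open>E2\<close>; \<open>quads\<close> settles the case of one
        pair on each side.\<close>
      have 1: "e \<in> E1 \<and> f \<in> E1 \<or> e \<in> E2 \<and> f \<in> E2" using not_cross mem cr by blast
      have 2: "e' \<in> E1 \<and> f' \<in> E1 \<or> e' \<in> E2 \<and> f' \<in> E2" using not_cross mem cr by blast
      have same: "card ((ends e \<union> ends f) \<inter> (ends e' \<union> ends f')) < 2"
        if "nic_segments E" "e \<in> E" "f \<in> E" "e' \<in> E" "f' \<in> E" for E
        using that cr neq by (intro nic_segments_quads)
      show "card ((ends e \<union> ends f) \<inter> (ends e' \<union> ends f')) < 2"
        using 1 2 same[OF nic1] same[OF nic2] quads[of e f e' f'] quads[of e' f' e f] cr
        by (auto simp: Int_commute)
    qed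
  qed
qed

section \<open>Invariance under invertible affine maps\<close>

definition affine_map :: "real \<Rightarrow> real \<Rightarrow> real \<Rightarrow> real \<Rightarrow> complex \<Rightarrow> complex \<Rightarrow> complex" where
  "affine_map \<alpha> \<beta> \<gamma> \<delta> c z = c + Complex (\<alpha> * Re z + \<beta> * Im z) (\<gamma> * Re z + \<delta> * Im z)"

context
  fixes \<alpha> \<beta> \<gamma> \<delta> :: real and c :: complex and F :: "complex \<Rightarrow> complex"
  assumes det: "\<alpha> * \<delta> - \<beta> * \<gamma> \<noteq> 0"
  defines "F \<equiv> affine_map \<alpha> \<beta> \<gamma> \<delta> c"
begin

lemma affine_map_combination: "F ((1 - t) *\<^sub>R a + t *\<^sub>R b) = (1 - t) *\<^sub>R F a + t *\<^sub>R F b"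
  by (simp add: F_def affine_map_def complex_eq_iff algebra_simps)

lemma inj_affine_map: "inj F"
proof (rule injI)
  fix z w assume "F z = F w"
  then have *: "\<alpha> * (Re z - Re w) + \<beta> * (Im z - Im w) = 0"
    "\<gamma> * (Re z - Re w) + \<delta> * (Im z - Im w) = 0"
    by (simp_all add: F_def affine_map_def complex_eq_iff algebra_simps)
  \<comment> \<open>The two equations are combined by the adjugate matrix.\<close>
  have "(\<alpha> * \<delta> - \<beta> * \<gamma>) * (Re z - Re w) =
      \<delta> * (\<alpha> * (Re z - Re w) + \<beta> * (Im z - Im w)) - \<beta> * (\<gamma> * (Re z - Re w) + \<delta> * (Im z - Im w))"
    by (simp add: algebra_simps)
  moreover have "(\<alpha> * \<delta> - \<beta> * \<gamma>) * (Im z - Im w) =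
      \<alpha> * (\<gamma> * (Re z - Re w) + \<delta> * (Im z - Im w)) - \<gamma> * (\<alpha> * (Re z - Re w) + \<beta> * (Im z - Im w))"
    by (simp add: algebra_simps)
  ultimately have "(\<alpha> * \<delta> - \<beta> * \<gamma>) * (Re z - Re w) = 0" "(\<alpha> * \<delta> - \<beta> * \<gamma>) * (Im z - Im w) = 0"
    unfolding * by simp_all
  then show "z = w" using det unfolding mult_eq_0_iff by (simp add: complex_eq_iff)
qed

lemma orient_affine_map: "orient (F a) (F b) (F z) = (\<alpha> * \<delta> - \<beta> * \<gamma>) * orient a b z"
  by (simp add: orient_def F_def affine_map_def algebra_simps)

text \<open>Orientations are multiplied by the determinant, which may be negative, but their
  products by its square.\<close>

lemma crosses_affine_map: "crosses (map_prod F F e) (map_prod F F f) \<longleftrightarrow> crosses e f"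
proof -
  have "(\<alpha> * \<delta> - \<beta> * \<gamma>) * x * ((\<alpha> * \<delta> - \<beta> * \<gamma>) * y) < 0 \<longleftrightarrow> x * y < 0" for x y
  proof -
    have "(\<alpha> * \<delta> - \<beta> * \<gamma>) * x * ((\<alpha> * \<delta> - \<beta> * \<gamma>) * y) = (\<alpha> * \<delta> - \<beta> * \<gamma>)\<^sup>2 * (x * y)"
      by (simp add: power2_eq_square)
    moreover have "(\<alpha> * \<delta> - \<beta> * \<gamma>)\<^sup>2 > 0" using det by simp
    ultimately show ?thesis by (metis mult_less_0_iff not_less_iff_gr_or_eq)
  qed
  then show ?thesis by (simp add: crosses_def orient_affine_map)
qed

lemma ends_affine_map: "ends (map_prod F F e) = F ` ends e"
  by (simp add: ends_def)

lemma verts_affine_map: "verts (map_prod F F ` E) = F ` verts E"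
  by (force simp: verts_def)

lemma seg_affine_map: "seg (map_prod F F e) = F ` seg e"
proof -
  have "seg e = (\<lambda>t. (1 - t) *\<^sub>R fst e + t *\<^sub>R snd e) ` {0..1}" for e
    unfolding seg_def closed_segment_def by force
  then show ?thesis by (simp add: image_image affine_map_combination)
qed

lemma nic_segments_affine_map:
  assumes "nic_segments E"
  shows "nic_segments (map_prod F F ` E)"
proof -
  let ?F = "map_prod F F"
  have fst_snd: "fst ` ?F ` E = F ` fst ` E" "snd ` ?F ` E = F ` snd ` E" by force+
  have Int: "F ` A \<inter> F ` B = F ` (A \<inter> B)" for A B
    using image_Int[OF inj_affine_map] by simp
  have sub: "F ` A \<subseteq> F ` B \<longleftrightarrow> A \<subseteq> B" for A B
    using inj_image_subset_iff[OF inj_affine_map] .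
  have card: "card (F ` A) = card A" for A
    using card_image[OF inj_on_subset[OF inj_affine_map]] by blast
  have eq: "?F e = ?F f \<longleftrightarrow> e = f" for e f
    using inj_affine_map by (cases e, cases f) (auto dest: injD)
  have "finite E" "fst ` E \<inter> snd ` E = {}"
    using assms by (auto simp: nic_segments_def)
  with assms show ?thesis
    unfolding nic_segments_def
    by (simp add: fst_snd Int verts_affine_map seg_affine_map ends_affine_map sub eq
        crosses_affine_map card doubleton_eq_iff flip: image_Un)
qed

end

section \<open>Certificates over integer points\<close>

type_synonym ipoint = "int \<times> int"

definition pt :: "ipoint \<Rightarrow> complex" where
  "pt a = Complex (of_int (fst a)) (of_int (snd a))"

lemma pt_eq_iff [simp]: "pt a = pt b \<longleftrightarrow> a = b"
  by (auto simp: pt_def prod_eq_iff)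

lemma inj_pt: "inj pt"
  by (simp add: inj_def)

definition iorient :: "ipoint \<Rightarrow> ipoint \<Rightarrow> ipoint \<Rightarrow> int" where
  "iorient a b c = (fst b - fst a) * (snd c - snd a) - (snd b - snd a) * (fst c - fst a)"

lemma orient_pt [simp]: "orient (pt a) (pt b) (pt c) = of_int (iorient a b c)"
  by (simp add: orient_def pt_def iorient_def)

definition iedge :: "ipoint \<times> ipoint \<Rightarrow> complex \<times> complex" where
  "iedge = map_prod pt pt"

lemma iedge_simps [simp]: "fst (iedge e) = pt (fst e)" "snd (iedge e) = pt (snd e)"
  by (simp_all add: iedge_def)

lemma iedge_eq_iff [simp]: "iedge e = iedge f \<longleftrightarrow> e = f"
  by (simp add: prod_eq_iff)

lemma iedge_image: "fst ` iedge ` A = pt ` fst ` A" "snd ` iedge ` A = pt ` snd ` A"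
  by (simp_all add: image_image)

lemma verts_iedge: "verts (iedge ` set es) = pt ` set (map fst es @ map snd es)"
  by (simp add: verts_def iedge_image image_Un)

definition icrosses :: "ipoint \<times> ipoint \<Rightarrow> ipoint \<times> ipoint \<Rightarrow> bool" where
  "icrosses e f \<longleftrightarrow>
     iorient (fst e) (snd e) (fst f) * iorient (fst e) (snd e) (snd f) < 0 \<and>
     iorient (fst f) (snd f) (fst e) * iorient (fst f) (snd f) (snd e) < 0"

lemma crosses_iedge: "crosses (iedge e) (iedge f) \<longleftrightarrow> icrosses e f"
  unfolding crosses_def icrosses_def by (simp flip: of_int_mult)

section \<open>Exact tests for segments that meet only in common ends\<close>

definition idot :: "ipoint \<Rightarrow> ipoint \<Rightarrow> ipoint \<Rightarrow> int" where
  "idot a b c = (fst b - fst a) * (fst c - fst a) + (snd b - snd a) * (snd c - snd a)"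

definition one_sided :: "ipoint \<times> ipoint \<Rightarrow> ipoint \<times> ipoint \<Rightarrow> bool" where
  "one_sided e f \<longleftrightarrow> iorient (fst e) (snd e) (fst f) * iorient (fst e) (snd e) (snd f) > 0"

text \<open>Comparison of the projections to an axis, for collinear segments and for points on the
  line of an edge, where all orientations vanish.\<close>

definition before :: "(ipoint \<Rightarrow> int) \<Rightarrow> ipoint \<times> ipoint \<Rightarrow> ipoint \<times> ipoint \<Rightarrow> bool" where
  "before \<pi> e f \<longleftrightarrow> max (\<pi> (fst e)) (\<pi> (snd e)) < min (\<pi> (fst f)) (\<pi> (snd f))"

text \<open>The second disjunct admits edges leaving \<open>a\<close> in opposite directions on one
  line, as at the hexagon vertices lying on the sides of a triangle.\<close>

definition fan :: "ipoint \<Rightarrow> ipoint \<Rightarrow> ipoint \<Rightarrow> bool" where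
  "fan a b c \<longleftrightarrow> iorient a b c \<noteq> 0 \<or> idot a b c < 0"

definition separated :: "ipoint \<times> ipoint \<Rightarrow> ipoint \<times> ipoint \<Rightarrow> bool" where
  "separated e f \<longleftrightarrow>
     one_sided e f \<or> one_sided f e \<or>
     before fst e f \<or> before fst f e \<or> before snd e f \<or> before snd f e \<or>
     fst e = fst f \<and> fan (fst e) (snd e) (snd f) \<or>
     snd e = snd f \<and> fan (snd e) (fst e) (fst f)"

text \<open>The orientation with respect to \<open>e\<close> vanishes on \<open>e\<close> and keeps
  a strict sign on \<open>f\<close>.\<close>

lemma one_sided_disjoint:
  assumes "one_sided e f"
  shows "seg (iedge e) \<inter> seg (iedge f) = {}"
proof (rule ccontr)
  assume "seg (iedge e) \<inter> seg (iedge f) \<noteq> {}"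
  then obtain z where z: "z \<in> seg (iedge e)" "z \<in> seg (iedge f)" by blast
  define x y where "x = iorient (fst e) (snd e) (fst f)" and "y = iorient (fst e) (snd e) (snd f)"
  have "orient (pt (fst e)) (pt (snd e)) z = 0"
    using z(1) by (auto elim!: mem_segE simp: orient_affine)
  moreover obtain t :: real where t: "0 \<le> t" "t \<le> 1"
    "orient (pt (fst e)) (pt (snd e)) z = (1 - t) * x + t * y"
    using z(2) by (auto elim!: mem_segE simp: orient_affine x_def y_def)
  moreover have "x > 0 \<and> y > 0 \<or> x < 0 \<and> y < 0"
    using assms by (auto simp: one_sided_def x_def y_def zero_less_mult_iff)
  ultimately show False
    using convex_bound_lt[of "- real_of_int x" 0 "- real_of_int y" "1 - t" t]
      convex_bound_lt[of "real_of_int x" 0 "real_of_int y" "1 - t" t] by auto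
qed

lemma before_disjoint:
  assumes "before \<pi> e f" and "\<pi> = fst \<or> \<pi> = snd"
  shows "seg (iedge e) \<inter> seg (iedge f) = {}"
proof (rule ccontr)
  assume "seg (iedge e) \<inter> seg (iedge f) \<noteq> {}"
  then obtain z where z: "z \<in> seg (iedge e)" "z \<in> seg (iedge f)" by blast
  \<comment> \<open>The real coordinate that extends \<pi> from integer points to the plane.\<close>
  define \<rho> where "\<rho> = (if \<pi> = fst then Re else Im)"
  have pt: "\<rho> (pt a) = \<pi> a" for a
    using assms(2) by (auto simp: \<rho>_def pt_def)
  have lin: "\<rho> ((1 - t) *\<^sub>R a + t *\<^sub>R b) = (1 - t) * \<rho> a + t * \<rho> b" for a b t
    by (auto simp: \<rho>_def)
  obtain s :: real where s: "0 \<le> s" "s \<le> 1" "\<rho> z = (1 - s) * \<pi> (fst e) + s * \<pi> (snd e)"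
    using z(1) by (auto elim!: mem_segE simp: lin pt)
  obtain t :: real where t: "0 \<le> t" "t \<le> 1" "\<rho> z = (1 - t) * \<pi> (fst f) + t * \<pi> (snd f)"
    using z(2) by (auto elim!: mem_segE simp: lin pt)
  define m n where "m = max (\<pi> (fst e)) (\<pi> (snd e))" and "n = min (\<pi> (fst f)) (\<pi> (snd f))"
  have "\<rho> z \<le> m"
    unfolding s(3) using s by (intro convex_bound_le) (auto simp: m_def)
  moreover have "- \<rho> z \<le> - real_of_int n"
  proof -
    have "(1 - t) * (- real_of_int (\<pi> (fst f))) + t * (- real_of_int (\<pi> (snd f))) \<le> - real_of_int n"
      using t by (intro convex_bound_le) (auto simp: n_def)
    then show ?thesis using t(3) by (simp add: algebra_simps)
  qed
  moreover have "m < n" using assms(1) by (simp add: before_def m_def n_def)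
  ultimately show False by linarith
qed

text \<open>Unless the points are collinear, \<open>orient (pt a) (pt b)\<close> vanishes on the
  second segment only at \<open>pt a\<close>; in the collinear case the segments leave
  \<open>pt a\<close> in opposite directions.\<close>

lemma fan_common_point:
  assumes "fan a b c" "z \<in> closed_segment (pt a) (pt b)" "z \<in> closed_segment (pt a) (pt c)"
  shows "z = pt a"
proof -
  obtain s where s: "0 \<le> s" "z = (1 - s) *\<^sub>R pt a + s *\<^sub>R pt b"
    using assms(2) by (auto simp: closed_segment_def)
  obtain t where t: "0 \<le> t" "z = (1 - t) *\<^sub>R pt a + t *\<^sub>R pt c"
    using assms(3) by (auto simp: closed_segment_def)
  show ?thesis
  proof (cases "iorient a b c = 0")
    case False
    have "orient (pt a) (pt b) z = 0"
      unfolding s(2) by (simp add: orient_affine)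
    moreover have "orient (pt a) (pt b) z = t * iorient a b c"
      unfolding t(2) by (simp add: orient_affine)
    ultimately have "t = 0" using False by simp
    then show ?thesis using t by simp
  next
    case True
    then have neg: "idot a b c < 0" using assms(1) by (simp add: fan_def)
    have "s *\<^sub>R (pt b - pt a) = t *\<^sub>R (pt c - pt a)"
      using s(2) t(2) by (simp add: algebra_simps)
    then have 1: "s * (fst b - fst a) = t * (fst c - fst a)" "s * (snd b - snd a) = t * (snd c - snd a)"
      by (simp_all add: pt_def complex_eq_iff)
    \<comment> \<open>Taking the inner product of both expressions for \<open>z - pt a\<close> with
      \<open>b - a\<close> forces \<open>s = 0\<close>.\<close>
    have "s * idot a b b = (fst b - fst a) * (s * (fst b - fst a)) + (snd b - snd a) * (s * (snd b - snd a))"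
      by (simp add: idot_def algebra_simps)
    also have "\<dots> = t * idot a b c"
      unfolding 1 by (simp add: idot_def algebra_simps)
    finally have "s * idot a b b \<le> 0"
      using neg t(1) by (simp add: mult_nonneg_nonpos)
    moreover have "idot a b b > 0"
    proof -
      have "fst b \<noteq> fst a \<or> snd b \<noteq> snd a" using neg by (auto simp: idot_def)
      then show ?thesis
        by (auto simp: idot_def sum_squares_gt_zero_iff)
    qed
    ultimately have "s = 0" using s(1) by (simp add: mult_le_0_iff)
    then show ?thesis using s by simp
  qed
qed

lemma separated_seg:
  assumes "separated e f"
  shows "seg (iedge e) \<inter> seg (iedge f) \<subseteq> ends (iedge e) \<inter> ends (iedge f)"
proof
  fix z assume z: "z \<in> seg (iedge e) \<inter> seg (iedge f)"
  then consider "fst e = fst f" "fan (fst e) (snd e) (snd f)" | "snd e = snd f" "fan (snd e) (fst e) (fst f)"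
    using assms one_sided_disjoint[of e f] one_sided_disjoint[of f e]
      before_disjoint[of _ e f] before_disjoint[of _ f e]
    unfolding separated_def by blast
  then show "z \<in> ends (iedge e) \<inter> ends (iedge f)"
  proof cases
    case 1
    then show ?thesis
      using fan_common_point[OF 1(2)] z by (simp add: seg_def ends_def)
  next
    case 2
    then show ?thesis
      using fan_common_point[OF 2(2)] z by (simp add: seg_def ends_def closed_segment_commute)
  qed
qed

section \<open>Computable certificates for \<open>nic_segments\<close>\<close>

definition quad :: "(ipoint \<times> ipoint) \<times> (ipoint \<times> ipoint) \<Rightarrow> ipoint list" where
  "quad k = [fst (fst k), snd (fst k), fst (snd k), snd (snd k)]"

lemma ends_quad: "ends (iedge e) \<union> ends (iedge f) = pt ` set (quad (e, f))"
  by (auto simp: ends_def quad_def)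

lemma quad_swap: "set (quad (e, f)) = set (quad (f, e))"
  by (auto simp: quad_def)

text \<open>\<open>ks\<close> lists the crossing pairs among the edges \<open>es\<close>, each in one order.\<close>

definition nic_check ::
  "(ipoint \<times> ipoint) list \<Rightarrow> ((ipoint \<times> ipoint) \<times> (ipoint \<times> ipoint)) list \<Rightarrow> bool" where
  "nic_check es ks \<longleftrightarrow>
     list_all (\<lambda>e. list_all (\<lambda>f. fst e \<noteq> snd f) es) es \<and>
     list_all (\<lambda>e. list_all (\<lambda>v. v = fst e \<or> v = snd e \<or> separated e (v, v)) (map fst es @ map snd es)) es \<and>
     list_all (\<lambda>e. list_all (\<lambda>f. e = f \<or> separated e f \<or> (e, f) \<in> set ks \<or> (f, e) \<in> set ks) es) es \<and>
     list_all (\<lambda>(e, f). icrosses e f) ks \<and>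
     list_all (\<lambda>k. list_all (\<lambda>l. k = l \<or> length (filter (\<lambda>x. x \<in> set (quad l)) (quad k)) < 2) ks) ks"

text \<open>By the third clause of \<open>nic_check\<close>, distinct edges not paired in
  \<open>ks\<close> are separated, and separated edges do not cross.\<close>

lemma nic_check_crosses:
  assumes "nic_check es ks" "e \<in> set es" "f \<in> set es" "crosses (iedge e) (iedge f)"
  shows "(e, f) \<in> set ks \<or> (f, e) \<in> set ks"
proof -
  have "\<not> separated e f"
    using separated_seg crosses_not_seg_subset_ends[OF assms(4)] by blast
  moreover have "e \<noteq> f"
    using crosses_imp_ends_disjoint[OF assms(4)] by (auto simp: ends_def)
  ultimately show ?thesis
    using assms(1-3) by (auto simp: nic_check_def list_all_iff)
qed

lemma nic_check_sound:
  assumes chk: "nic_check es ks"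
  shows "nic_segments (iedge ` set es)"
  unfolding nic_segments_def
proof (intro conjI)
  show "finite (iedge ` set es)" by simp
  show "fst ` iedge ` set es \<inter> snd ` iedge ` set es = {}"
  proof -
    have "fst e \<noteq> snd f" if "e \<in> set es" "f \<in> set es" for e f
      using chk that by (simp add: nic_check_def list_all_iff)
    then show ?thesis by (fastforce simp: image_image)
  qed
  show "\<forall>e\<in>iedge ` set es. seg e \<inter> verts (iedge ` set es) \<subseteq> ends e"
  proof (intro ballI subsetI, elim imageE IntE)
    fix e' z e assume e: "e' = iedge e" "e \<in> set es" and z: "z \<in> seg e'" "z \<in> verts (iedge ` set es)"
    then obtain v where v: "v \<in> set (map fst es @ map snd es)" "z = pt v"
      unfolding verts_iedge by blast
    \<comment> \<open>A vertex is tested against an edge as the degenerate segment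
      \<open>(v, v)\<close>.\<close>
    have "v = fst e \<or> v = snd e \<or> separated e (v, v)"
      using chk e(2) v(1) by (simp only: nic_check_def list_all_iff)
    moreover have "z \<in> seg (iedge (v, v))" by (simp add: v seg_def)
    then have "z \<in> ends e'" if "separated e (v, v)"
      using that z(1) separated_seg unfolding e(1) by blast
    ultimately show "z \<in> ends e'"
      unfolding e(1) v(2) by (auto simp: ends_def)
  qed
  show "\<forall>e\<in>iedge ` set es. \<forall>f\<in>iedge ` set es. e \<noteq> f \<longrightarrow>
      seg e \<inter> seg f \<subseteq> ends e \<inter> ends f \<or> crosses e f"
  proof (intro ballI impI, elim imageE)
    fix e' f' e f assume ef: "e' = iedge e" "e \<in> set es" "f' = iedge f" "f \<in> set es" "e' \<noteq> f'"
    have "separated e f \<or> (e, f) \<in> set ks \<or> (f, e) \<in> set ks"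
      using chk ef by (auto simp: nic_check_def list_all_iff)
    moreover have "icrosses e f" if "(e, f) \<in> set ks" for e f
      using chk that by (auto simp: nic_check_def list_all_iff)
    ultimately show "seg e' \<inter> seg f' \<subseteq> ends e' \<inter> ends f' \<or> crosses e' f'"
      using separated_seg crosses_iedge crosses_commute ef by metis
  qed
  show "\<forall>e\<in>iedge ` set es. \<forall>f\<in>iedge ` set es. \<forall>e'\<in>iedge ` set es. \<forall>f'\<in>iedge ` set es.
      crosses e f \<and> crosses e' f' \<and> {e, f} \<noteq> {e', f'} \<longrightarrow>
      card ((ends e \<union> ends f) \<inter> (ends e' \<union> ends f')) < 2"
  proof (intro ballI impI, elim imageE conjE)
    fix e0 f0 e1 f1 e f e' f'
    assume eqs: "e0 = iedge e" "f0 = iedge f" "e1 = iedge e'" "f1 = iedge f'"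
      and mem: "e \<in> set es" "f \<in> set es" "e' \<in> set es" "f' \<in> set es"
      and cr: "crosses e0 f0" "crosses e1 f1" and neq: "{e0, f0} \<noteq> {e1, f1}"
    obtain k where k: "k \<in> set ks" "k = (e, f) \<or> k = (f, e)"
      using nic_check_crosses[OF chk mem(1,2)] cr eqs by blast
    obtain l where l: "l \<in> set ks" "l = (e', f') \<or> l = (f', e')"
      using nic_check_crosses[OF chk mem(3,4)] cr eqs by blast
    have "k \<noteq> l" using k(2) l(2) neq eqs by auto
    then have lt: "length (filter (\<lambda>x. x \<in> set (quad l)) (quad k)) < 2"
      using chk k(1) l(1) by (auto simp: nic_check_def list_all_iff)
    have "ends e0 \<union> ends f0 = pt ` set (quad k)" "ends e1 \<union> ends f1 = pt ` set (quad l)"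
      using k(2) l(2) ends_quad quad_swap eqs by metis+
    then have "(ends e0 \<union> ends f0) \<inter> (ends e1 \<union> ends f1) =
        pt ` set (filter (\<lambda>x. x \<in> set (quad l)) (quad k))"
      by auto
    \<comment> \<open>Repeated entries could only lengthen the list, so the count in
      \<open>nic_check\<close> is an upper bound.\<close>
    also have "card \<dots> \<le> length (filter (\<lambda>x. x \<in> set (quad l)) (quad k))"
      by (metis card_image_le card_length finite_set le_trans)
    finally show "card ((ends e0 \<union> ends f0) \<inter> (ends e1 \<union> ends f1)) < 2"
      using lt by linarith
  qed
qed

section \<open>Frames around a triangular hole\<close>

text \<open>The barycentric coordinates \<open>u\<close>, \<open>v\<close>, \<open>w\<close> of
  \<open>z\<close> are ratios of signed areas.\<close>

lemma mem_triangle: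
  assumes "orient p q r > 0" "orient q r z \<ge> 0" "orient r p z \<ge> 0" "orient p q z \<ge> 0"
  shows "z \<in> convex hull {p, q, r}"
proof -
  define D where "D = orient p q r"
  define u v w where "u = orient q r z / D" and "v = orient r p z / D" and "w = orient p q z / D"
  have D: "D > 0" using assms by (simp add: D_def)
  have uvw: "u * D = orient q r z" "v * D = orient r p z" "w * D = orient p q z"
    using D by (simp_all add: u_def v_def w_def)
  have "D * (u + v + w) = D * 1"
    using uvw by (simp add: algebra_simps) (simp add: D_def orient_def algebra_simps)
  then have "u + v + w = 1" using D by simp
  moreover have "D * Re (u *\<^sub>R p + v *\<^sub>R q + w *\<^sub>R r) = D * Re z"
  proof -
    have "D * Re (u *\<^sub>R p + v *\<^sub>R q + w *\<^sub>R r) = (u * D) * Re p + (v * D) * Re q + (w * D) * Re r"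
      by (simp add: algebra_simps)
    also have "\<dots> = D * Re z"
      unfolding uvw by (simp add: D_def orient_def algebra_simps)
    finally show ?thesis .
  qed
  moreover have "D * Im (u *\<^sub>R p + v *\<^sub>R q + w *\<^sub>R r) = D * Im z"
  proof -
    have "D * Im (u *\<^sub>R p + v *\<^sub>R q + w *\<^sub>R r) = (u * D) * Im p + (v * D) * Im q + (w * D) * Im r"
      by (simp add: algebra_simps)
    also have "\<dots> = D * Im z"
      unfolding uvw by (simp add: D_def orient_def algebra_simps)
    finally show ?thesis .
  qed
  ultimately have "z = u *\<^sub>R p + v *\<^sub>R q + w *\<^sub>R r" "u + v + w = 1"
    using D by (simp_all add: complex_eq_iff)
  moreover have "0 \<le> u" "0 \<le> v" "0 \<le> w"
    using D assms by (simp_all add: u_def v_def w_def)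
  ultimately show ?thesis
    unfolding convex_hull_3 by blast
qed

text \<open>
  A hexagon is a list of six vertices in cyclic order; it is drawn as a triangle whose corners are
  the vertices with odd index, the others lying on the sides.
\<close>

definition corners :: "ipoint list \<Rightarrow> ipoint list" where
  "corners hs = [hs ! 1, hs ! 3, hs ! 5]"

definition evens :: "ipoint list \<Rightarrow> ipoint list" where
  "evens hs = [hs ! 0, hs ! 2, hs ! 4]"

text \<open>One of the two perfect matchings of the 6-cycle. On the cycle around a hole these sides
  are reserved for the crossings of the frame, and the complementary ones for the patch
  inside.\<close>

definition pairs :: "ipoint list \<Rightarrow> (ipoint \<times> ipoint) list" where
  "pairs hs = [(hs ! 0, hs ! 1), (hs ! 2, hs ! 3), (hs ! 4, hs ! 5)]"

definition corner_hull :: "ipoint list \<Rightarrow> complex set" where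
  "corner_hull hs = convex hull (pt ` set (corners hs))"

lemma convex_corner_hull: "convex (corner_hull hs)"
  by (simp add: corner_hull_def)

text \<open>A line through two corners separates \<open>v\<close> strictly from the triangle. All
  ordered pairs are tried, so the corners may be listed in either sense of rotation.\<close>

definition beyond :: "ipoint list \<Rightarrow> ipoint \<Rightarrow> bool" where
  "beyond cs v \<longleftrightarrow>
     list_ex (\<lambda>p. list_ex (\<lambda>q.
       list_all (\<lambda>c. iorient p q c \<ge> 0) cs \<and> iorient p q v < 0) cs) cs"

text \<open>The edge may start on the line of a triangle side, as it does at a vertex of the hole,
  but may not run along it.\<close>

definition avoids :: "ipoint list \<Rightarrow> ipoint \<times> ipoint \<Rightarrow> bool" where
  "avoids cs e \<longleftrightarrow>
     list_ex (\<lambda>p. list_ex (\<lambda>q.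
       list_all (\<lambda>c. iorient p q c \<ge> 0) cs \<and>
       iorient p q (fst e) \<le> 0 \<and> iorient p q (snd e) \<le> 0 \<and>
       (iorient p q (fst e) \<noteq> 0 \<or> iorient p q (snd e) \<noteq> 0)) cs) cs"

lemma orient_convex_hull_nonneg:
  assumes "\<And>c. c \<in> S \<Longrightarrow> orient p q c \<ge> 0" "z \<in> convex hull S"
  shows "orient p q z \<ge> 0"
proof -
  have "convex hull S \<subseteq> {z. orient p q z \<ge> 0}"
    using assms(1) by (intro hull_minimal) (auto simp: convex_alt orient_affine)
  then show ?thesis using assms(2) by blast
qed

lemma beyond_notin_hull:
  assumes "beyond (corners hs) v"
  shows "pt v \<notin> corner_hull hs"
proof
  assume v: "pt v \<in> corner_hull hs"
  obtain p q where pq: "\<forall>c\<in>set (corners hs). iorient p q c \<ge> 0" "iorient p q v < 0"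
    using assms by (auto simp: beyond_def list_all_iff list_ex_iff)
  have "orient (pt p) (pt q) (pt v) \<ge> 0"
    using pq(1) by (intro orient_convex_hull_nonneg[OF _ v[unfolded corner_hull_def]]) auto
  then show False using pq(2) by simp
qed

text \<open>\<open>orient\<close> for the separating line is nonnegative on the hull and nonpositive
  on the edge, where it can vanish only at an end.\<close>

lemma avoids_hull:
  assumes "avoids (corners hs) e"
  shows "seg (iedge e) \<inter> corner_hull hs \<subseteq> ends (iedge e)"
proof (intro subsetI, elim IntE)
  fix z assume z: "z \<in> seg (iedge e)" "z \<in> corner_hull hs"
  obtain p q where pq: "\<forall>c\<in>set (corners hs). iorient p q c \<ge> 0"
    "iorient p q (fst e) \<le> 0" "iorient p q (snd e) \<le> 0"
    "iorient p q (fst e) \<noteq> 0 \<or> iorient p q (snd e) \<noteq> 0"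
    using assms unfolding avoids_def list_all_iff list_ex_iff by blast
  have ge: "orient (pt p) (pt q) z \<ge> 0"
    using pq(1) by (intro orient_convex_hull_nonneg[OF _ z(2)[unfolded corner_hull_def]]) auto
  obtain t where t: "0 \<le> t" "t \<le> 1" "z = (1 - t) *\<^sub>R pt (fst e) + t *\<^sub>R pt (snd e)"
    using z(1) by (auto elim: mem_segE)
  have "(1 - t) * real_of_int (iorient p q (fst e)) \<le> 0" "t * real_of_int (iorient p q (snd e)) \<le> 0"
    using t pq by (auto intro: mult_nonneg_nonpos)
  moreover have "(1 - t) * real_of_int (iorient p q (fst e)) + t * real_of_int (iorient p q (snd e)) \<ge> 0"
    using ge unfolding t(3) orient_affine by simp
  ultimately have "(1 - t) * real_of_int (iorient p q (fst e)) = 0" "t * real_of_int (iorient p q (snd e)) = 0"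
    by linarith+
  then have "t = 1 \<or> t = 0" using pq(4) by auto
  then show "z \<in> ends (iedge e)"
    using t(3) by (auto simp: ends_def)
qed

section \<open>Patches filling the base triangle and frames around a hole\<close>

definition base_hexagon :: "ipoint list" where
  "base_hexagon = [(0, -4), (8, 0), (4, 4), (0, 8), (-4, 0), (-8, -8)]"

text \<open>
  A drawing inside the base triangle that can be put inside a frame. The last condition says that
  no crossing pair has both vertices of one of the three distinguished sides of the hexagon among
  its endpoints: the crossing pairs of a surrounding frame are allowed to use these sides.
\<close>

definition patch :: "(complex \<times> complex) set \<Rightarrow> bool" where
  "patch E \<longleftrightarrow>
     nic_segments E \<and> verts E \<subseteq> corner_hull base_hexagon \<and>
     pt ` set (evens base_hexagon) \<subseteq> fst ` E \<and> pt ` set (corners base_hexagon) \<subseteq> snd ` E \<and>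
     (\<forall>e\<in>E. \<forall>f\<in>E. crosses e f \<longrightarrow>
        (\<forall>(m, m')\<in>set (pairs base_hexagon). \<not> (pt m \<in> ends e \<union> ends f \<and> pt m' \<in> ends e \<union> ends f)))"

lemma patch_quad:
  assumes "patch E" "e \<in> E" "f \<in> E" "crosses e f" "(m, m') \<in> set (pairs base_hexagon)"
  shows "\<not> (pt m \<in> ends e \<union> ends f \<and> pt m' \<in> ends e \<union> ends f)"
proof -
  have "\<forall>(m, m')\<in>set (pairs base_hexagon). \<not> (pt m \<in> ends e \<union> ends f \<and> pt m' \<in> ends e \<union> ends f)"
    using assms(1-4) by (simp add: patch_def)
  then show ?thesis using assms(5) by blast
qed

text \<open>The literal points are the corners of \<open>base_hexagon\<close> in counterclockwise
  order, so the inequalities place every vertex in the base triangle.\<close>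

definition patch_check ::
  "(ipoint \<times> ipoint) list \<Rightarrow> ((ipoint \<times> ipoint) \<times> (ipoint \<times> ipoint)) list \<Rightarrow> bool" where
  "patch_check es ks \<longleftrightarrow> nic_check es ks \<and>
     list_all (\<lambda>v. iorient (8, 0) (0, 8) v \<ge> 0 \<and> iorient (0, 8) (-8, -8) v \<ge> 0 \<and>
       iorient (-8, -8) (8, 0) v \<ge> 0) (map fst es @ map snd es) \<and>
     list_all (\<lambda>v. v \<in> set (map fst es)) (evens base_hexagon) \<and>
     list_all (\<lambda>v. v \<in> set (map snd es)) (corners base_hexagon) \<and>
     list_all (\<lambda>k. list_all (\<lambda>(m, m'). \<not> (m \<in> set (quad k) \<and> m' \<in> set (quad k))) (pairs base_hexagon)) ks"

lemma patch_check_sound: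
  assumes chk: "patch_check es ks"
  shows "patch (iedge ` set es)"
proof -
  have nic: "nic_check es ks" using chk by (simp add: patch_check_def)
  have "verts (iedge ` set es) \<subseteq> corner_hull base_hexagon"
  proof -
    have "pt v \<in> corner_hull base_hexagon" if "v \<in> set (map fst es @ map snd es)" for v
    proof -
      have "iorient (8, 0) (0, 8) v \<ge> 0" "iorient (0, 8) (-8, -8) v \<ge> 0" "iorient (-8, -8) (8, 0) v \<ge> 0"
        using chk that by (simp_all only: patch_check_def list_all_iff)
      then have "pt v \<in> convex hull {pt (8, 0), pt (0, 8), pt (-8, -8)}"
        by (intro mem_triangle) (auto simp: iorient_def)
      then show ?thesis
        by (simp add: corner_hull_def corners_def base_hexagon_def)
    qed
    then show ?thesis unfolding verts_iedge by blast
  qed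
  moreover have "pt ` set (evens base_hexagon) \<subseteq> fst ` iedge ` set es"
    "pt ` set (corners base_hexagon) \<subseteq> snd ` iedge ` set es"
    using chk unfolding patch_check_def list_all_iff iedge_image set_map by blast+
  moreover have "\<not> (pt m \<in> ends e \<union> ends f \<and> pt m' \<in> ends e \<union> ends f)"
    if mem: "e \<in> iedge ` set es" "f \<in> iedge ` set es" and cr: "crosses e f"
      and m: "(m, m') \<in> set (pairs base_hexagon)"
    for e f m m'
  proof -
    obtain e' f' where ef: "e = iedge e'" "f = iedge f'" "e' \<in> set es" "f' \<in> set es"
      using mem by blast
    then obtain k where k: "k \<in> set ks" "k = (e', f') \<or> k = (f', e')"
      using nic_check_crosses[OF nic] cr by blast
    then have "ends e \<union> ends f = pt ` set (quad k)"
      using ends_quad quad_swap ef by metis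
    moreover have "\<not> (m \<in> set (quad k) \<and> m' \<in> set (quad k))"
      using chk k(1) m by (auto simp: patch_check_def list_all_iff)
    ultimately show ?thesis by auto
  qed
  ultimately show ?thesis
    unfolding patch_def using nic_check_sound[OF nic] by blast
qed

text \<open>\<open>avoids\<close> excludes edges between two vertices of the hole; in the
  construction the sides of the hole are edges of the patch inside. The clauses on
  \<open>fst e\<close> and \<open>snd e\<close> make the colours of frame and patch agree
  there.\<close>

definition frame_check ::
  "(ipoint \<times> ipoint) list \<Rightarrow> ((ipoint \<times> ipoint) \<times> (ipoint \<times> ipoint)) list \<Rightarrow> ipoint list \<Rightarrow> bool" where
  "frame_check es ks hs \<longleftrightarrow> nic_check es ks \<and>
     list_all (avoids (corners hs)) es \<and>
     list_all (\<lambda>e. fst e \<in> set (evens hs) \<or> beyond (corners hs) (fst e)) es \<and>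
     list_all (\<lambda>e. snd e \<in> set (corners hs) \<or> beyond (corners hs) (snd e)) es \<and>
     list_all (\<lambda>k. list_ex (\<lambda>(m, m'). list_all (\<lambda>x. x = m \<or> x = m' \<or> beyond (corners hs) x) (quad k))
       (pairs hs)) ks \<and>
     length hs = 6 \<and> distinct hs \<and> list_all (\<lambda>h. h \<in> set (map fst es @ map snd es)) hs"

lemma set_six: "length hs = 6 \<Longrightarrow> set hs = {hs ! 0, hs ! 1, hs ! 2, hs ! 3, hs ! 4, hs ! 5}"
  by (auto simp: length_Suc_conv numeral_eq_Suc)

text \<open>\<open>nic_segments_Un\<close> applies with the hull of the hole as \<open>T\<close>.
  The summand 6 counts the vertices of the hole, which are exactly the common ones.\<close>

lemma frame_patch:
  assumes chk: "frame_check es ks hs" and patch: "patch E" and det: "\<alpha> * \<delta> - \<beta> * \<gamma> \<noteq> 0"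
    and F: "F = affine_map \<alpha> \<beta> \<gamma> \<delta> c" and Fhs: "\<And>i. i < 6 \<Longrightarrow> F (pt (base_hexagon ! i)) = pt (hs ! i)"
  defines "E1 \<equiv> iedge ` set es" and "E2 \<equiv> map_prod F F ` E"
  shows "nic_segments (E1 \<union> E2)"
    "card (E1 \<union> E2) = card (set es) + card E"
    "card (verts (E1 \<union> E2)) + 6 = card (set (map fst es @ map snd es)) + card (verts E)"
    "verts E2 \<subseteq> corner_hull hs"
    "\<And>e f. e \<in> E1 \<Longrightarrow> f \<in> E2 \<Longrightarrow> \<not> crosses e f"
proof -
  note aff = inj_affine_map[OF det, of c, folded F] affine_map_combination[OF det, of c, folded F]
    crosses_affine_map[OF det, of c, folded F] ends_affine_map[OF det, of c, folded F]
    verts_affine_map[OF det, of c, folded F] nic_segments_affine_map[OF det, of _ c, folded F]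
  have nic: "nic_check es ks" using chk by (simp add: frame_check_def)
  have nicE: "nic_segments E" using patch by (simp add: patch_def)
  have nic1: "nic_segments E1" unfolding E1_def using nic by (rule nic_check_sound)
  have nic2: "nic_segments E2" unfolding E2_def by (rule aff(6)[OF nicE])
  have Fevens: "pt ` set (evens hs) = F ` pt ` set (evens base_hexagon)"
    and Fcorners: "pt ` set (corners hs) = F ` pt ` set (corners base_hexagon)"
    using Fhs by (simp_all add: evens_def corners_def)
  \<comment> \<open>The preimage of a convex set under \<open>F\<close> is convex, so it suffices to
    look at the corners.\<close>
  have "corner_hull base_hexagon \<subseteq> F -` corner_hull hs"
    unfolding corner_hull_def
  proof (rule hull_minimal)
    show "pt ` set (corners base_hexagon) \<subseteq> F -` (convex hull pt ` set (corners hs))"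
      unfolding Fcorners by (auto simp: hull_inc)
    have "convex (corner_hull hs)" by (rule convex_corner_hull)
    then show "convex (F -` (convex hull pt ` set (corners hs)))"
      unfolding corner_hull_def[symmetric] convex_alt by (simp add: aff(2))
  qed
  then show verts2: "verts E2 \<subseteq> corner_hull hs"
    using patch unfolding E2_def aff(5) patch_def by blast
  have fst2: "pt ` set (evens hs) \<subseteq> fst ` E2"
  proof -
    have "fst ` E2 = F ` fst ` E" by (simp add: E2_def image_image)
    then show ?thesis unfolding Fevens using patch by (simp add: patch_def image_mono)
  qed
  have snd2: "pt ` set (corners hs) \<subseteq> snd ` E2"
  proof -
    have "snd ` E2 = F ` snd ` E" by (simp add: E2_def image_image)
    then show ?thesis unfolding Fcorners using patch by (simp add: patch_def image_mono)
  qed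
  have fst1: "fst ` E1 \<inter> corner_hull hs \<subseteq> pt ` set (evens hs)"
  proof -
    have "pt (fst e) \<in> pt ` set (evens hs)" if "e \<in> set es" "pt (fst e) \<in> corner_hull hs" for e
      using chk that beyond_notin_hull[of hs "fst e"] by (auto simp: frame_check_def list_all_iff)
    then show ?thesis by (auto simp: E1_def iedge_image)
  qed
  have snd1: "snd ` E1 \<inter> corner_hull hs \<subseteq> pt ` set (corners hs)"
  proof -
    have "pt (snd e) \<in> pt ` set (corners hs)" if "e \<in> set es" "pt (snd e) \<in> corner_hull hs" for e
      using chk that beyond_notin_hull[of hs "snd e"] by (auto simp: frame_check_def list_all_iff)
    then show ?thesis by (auto simp: E1_def iedge_image)
  qed
  have avoid: "seg e \<inter> corner_hull hs \<subseteq> ends e" if "e \<in> E1" for e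
    using that chk avoids_hull unfolding E1_def frame_check_def list_all_iff by blast
  \<comment> \<open>All ends of the frame's crossing pair except those of one side in
    \<open>pairs hs\<close> lie outside the hole, and a crossing pair of the patch never contains
    both ends of that side.\<close>
  have quads: "card ((ends e \<union> ends f) \<inter> (ends e' \<union> ends f')) < 2"
    if mem: "e \<in> E1" "f \<in> E1" "e' \<in> E2" "f' \<in> E2" and cr: "crosses e f" "crosses e' f'" for e f e' f'
  proof -
    obtain a b where ab: "e = iedge a" "f = iedge b" "a \<in> set es" "b \<in> set es"
      using mem unfolding E1_def by blast
    then obtain k where k: "k \<in> set ks" "k = (a, b) \<or> k = (b, a)"
      using nic_check_crosses[OF nic] cr(1) by blast
    then have q1: "ends e \<union> ends f = pt ` set (quad k)"
      using ends_quad quad_swap ab by metis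
    obtain m m' where m: "(m, m') \<in> set (pairs hs)" "\<forall>x\<in>set (quad k). x = m \<or> x = m' \<or> beyond (corners hs) x"
      using chk k(1) unfolding frame_check_def list_all_iff list_ex_iff by blast
    obtain n n' where n: "(n, n') \<in> set (pairs base_hexagon)" "F (pt n) = pt m" "F (pt n') = pt m'"
    proof -
      have "\<exists>i\<in>{0, 2, 4}. m = hs ! i \<and> m' = hs ! Suc i"
        using m(1) by (auto simp: pairs_def)
      then obtain i where "i \<in> {0, 2, 4}" "m = hs ! i" "m' = hs ! Suc i" by blast
      moreover from this have "(base_hexagon ! i, base_hexagon ! Suc i) \<in> set (pairs base_hexagon)"
        by (auto simp: pairs_def)
      ultimately show thesis
        using that[of "base_hexagon ! i" "base_hexagon ! Suc i"] Fhs[of i] Fhs[of "Suc i"] by auto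
    qed
    obtain a' b' where ab': "e' = map_prod F F a'" "f' = map_prod F F b'" "a' \<in> E" "b' \<in> E"
      using mem(3,4) unfolding E2_def by (metis imageE)
    have "crosses a' b'" using cr(2) aff(3) by (simp add: ab')
    then have "\<not> (pt n \<in> ends a' \<union> ends b' \<and> pt n' \<in> ends a' \<union> ends b')"
      using patch_quad[OF patch ab'(3,4)] n(1) by blast
    moreover have q2: "ends e' \<union> ends f' = F ` (ends a' \<union> ends b')"
      unfolding ab' aff(4) by blast
    ultimately have "\<not> (pt m \<in> ends e' \<union> ends f' \<and> pt m' \<in> ends e' \<union> ends f')"
      using inj_image_mem_iff[OF aff(1)] n(2,3) by metis
    moreover have "(ends e \<union> ends f) \<inter> (ends e' \<union> ends f') \<subseteq> {pt m, pt m'}"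
    proof -
      have "ends e' \<union> ends f' \<subseteq> corner_hull hs"
        using verts2 mem(3,4) ends_subset_verts by blast
      then have "x = m \<or> x = m'" if "x \<in> set (quad k)" "pt x \<in> ends e' \<union> ends f'" for x
        using that m(2) beyond_notin_hull by blast
      then show ?thesis unfolding q1 by blast
    qed
    ultimately have "(ends e \<union> ends f) \<inter> (ends e' \<union> ends f') \<subseteq> {pt m} \<or>
        (ends e \<union> ends f) \<inter> (ends e' \<union> ends f') \<subseteq> {pt m'}"
      by blast
    then have "card ((ends e \<union> ends f) \<inter> (ends e' \<union> ends f')) \<le> 1"
      by (metis card_mono finite.emptyI finite.insertI is_singletonI is_singleton_altdef)
    then show ?thesis by simp
  qed
  note Un = nic_segments_Un[OF nic1 nic2 convex_corner_hull verts2 avoid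
      order_trans[OF fst1 fst2] order_trans[OF snd1 snd2] quads]
  show "nic_segments (E1 \<union> E2)" by (rule Un(1))
  show "\<And>e f. e \<in> E1 \<Longrightarrow> f \<in> E2 \<Longrightarrow> \<not> crosses e f" by (rule Un(3))
  have inj2: "inj (map_prod F F)" using aff(1) by (simp add: prod.inj_map)
  have "card E1 = card (set es)" unfolding E1_def by (rule card_image) (simp add: inj_on_def)
  moreover have "card E2 = card E"
    unfolding E2_def by (rule card_image) (rule inj_on_subset[OF inj2 subset_UNIV])
  moreover have "finite E1" "finite E2" using nic1 nic2 by (auto simp: nic_segments_def)
  ultimately show "card (E1 \<union> E2) = card (set es) + card E"
    by (simp add: card_Un_disjoint Un(2))
  have hs: "set hs = set (evens hs) \<union> set (corners hs)"
    using chk set_six[of hs] by (auto simp: frame_check_def evens_def corners_def)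
  have "verts E1 \<inter> verts E2 = pt ` set hs"
  proof
    show "verts E1 \<inter> verts E2 \<subseteq> pt ` set hs"
      using fst1 snd1 verts2 unfolding hs image_Un verts_def by blast
    have "pt ` set hs \<subseteq> verts E1"
      using chk unfolding E1_def verts_iedge frame_check_def list_all_iff by blast
    moreover have "pt ` set hs \<subseteq> verts E2"
      using fst2 snd2 unfolding hs image_Un verts_def by blast
    ultimately show "pt ` set hs \<subseteq> verts E1 \<inter> verts E2" by simp
  qed
  moreover have "card (pt ` set hs) = 6"
  proof -
    have "card (set hs) = 6" using chk distinct_card[of hs] by (simp add: frame_check_def)
    then show ?thesis using card_image[OF inj_on_subset[OF inj_pt subset_UNIV]] by metis
  qed
  moreover have "verts (E1 \<union> E2) = verts E1 \<union> verts E2" by (auto simp: verts_def)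
  moreover have "finite (verts E1)" "finite (verts E2)"
    using \<open>finite E1\<close> \<open>finite E2\<close> by (auto simp: verts_def)
  moreover have "card (verts E1) = card (set (map fst es @ map snd es))"
    unfolding E1_def verts_iedge by (rule card_image) (simp add: inj_on_def)
  moreover have "card (verts E2) = card (verts E)"
    unfolding E2_def aff(5) by (rule card_image) (rule inj_on_subset[OF aff(1) subset_UNIV])
  ultimately show "card (verts (E1 \<union> E2)) + 6 = card (set (map fst es @ map snd es)) + card (verts E)"
    using card_Un_Int[of "verts E1" "verts E2"] by simp
qed

text \<open>The induction step of the nesting: crossings of the ring respect the outer sides by
  \<open>patch_check\<close>, and those of the copy inside have no end on the base hexagon, all of
  whose vertices lie beyond the hole.\<close>

lemma frame_patch_patch:
  assumes chk: "frame_check es ks hs" "patch_check es ks" "list_all (beyond (corners hs)) base_hexagon"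
    and patch: "patch E" and det: "\<alpha> * \<delta> - \<beta> * \<gamma> \<noteq> 0"
    and F: "F = affine_map \<alpha> \<beta> \<gamma> \<delta> c" and Fhs: "\<And>i. i < 6 \<Longrightarrow> F (pt (base_hexagon ! i)) = pt (hs ! i)"
  shows "patch (iedge ` set es \<union> map_prod F F ` E)"
proof -
  define E1 E2 where "E1 = iedge ` set es" and "E2 = map_prod F F ` E"
  note frame = frame_patch[OF chk(1) patch det F Fhs, folded E1_def E2_def]
  have patch1: "patch E1" unfolding E1_def using chk(2) by (rule patch_check_sound)
  have "pt ` set (corners hs) \<subseteq> corner_hull base_hexagon"
  proof -
    have "set (corners hs) \<subseteq> set hs" "set hs \<subseteq> set (map fst es @ map snd es)"
      using chk(1) by (auto simp: frame_check_def corners_def list_all_iff)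
    then have "pt ` set (corners hs) \<subseteq> verts E1" unfolding E1_def verts_iedge by blast
    then show ?thesis using patch1 by (auto simp: patch_def)
  qed
  then have sub: "corner_hull hs \<subseteq> corner_hull base_hexagon"
    unfolding corner_hull_def[of hs] using convex_corner_hull by (rule hull_minimal)
  have "verts (E1 \<union> E2) = verts E1 \<union> verts E2" by (auto simp: verts_def)
  then have verts: "verts (E1 \<union> E2) \<subseteq> corner_hull base_hexagon"
    using patch1 frame(4) sub by (auto simp: patch_def)
  have quads: "\<not> (pt m \<in> ends e \<union> ends f \<and> pt m' \<in> ends e \<union> ends f)"
    if "e \<in> E1 \<union> E2" "f \<in> E1 \<union> E2" "crosses e f" "(m, m') \<in> set (pairs base_hexagon)" for e f m m'
  proof (cases "e \<in> E1 \<and> f \<in> E1")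
    case True
    then show ?thesis using patch_quad[OF patch1] that by blast
  next
    case False
    then have "e \<in> E2" "f \<in> E2" using that(1-3) frame(5) crosses_commute by blast+
    then have "ends e \<union> ends f \<subseteq> corner_hull hs"
      using frame(4) ends_subset_verts by blast
    moreover have "m \<in> set base_hexagon" using that(4) by (auto simp: pairs_def base_hexagon_def)
    then have "pt m \<notin> corner_hull hs"
      using chk(3) beyond_notin_hull by (simp add: list_all_iff)
    ultimately show ?thesis by blast
  qed
  have "patch (E1 \<union> E2)"
    unfolding patch_def image_Un
  proof (intro conjI ballI impI)
    show "pt ` set (evens base_hexagon) \<subseteq> fst ` E1 \<union> fst ` E2"
      "pt ` set (corners base_hexagon) \<subseteq> snd ` E1 \<union> snd ` E2"
      using patch1 by (auto simp: patch_def intro: le_supI1)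
  qed (use frame(1) verts quads in \<open>auto simp only: case_prod_beta prod.collapse\<close>)
  then show ?thesis by (simp add: E1_def E2_def)
qed

section \<open>The family\<close>

definition core_crossings :: "((ipoint \<times> ipoint) \<times> (ipoint \<times> ipoint)) list" where
  "core_crossings =
     [(((0, 0), (8, 0)), ((4, 4), (0, -2))),
      (((0, 0), (0, 8)), ((-4, 0), (2, 2))),
      (((0, 0), (-8, -8)), ((0, -4), (-2, 0)))]"

text \<open>The inner cap: the vertex \<open>(0, 0)\<close> is joined through
  \<open>(0, -2)\<close>, \<open>(2, 2)\<close> and \<open>(-2, 0)\<close> to the even vertices of
  \<open>base_hexagon\<close>.\<close>

definition core_edges :: "(ipoint \<times> ipoint) list" where
  "core_edges =
     [((0, -4), (8, 0)), ((4, 4), (8, 0)), ((4, 4), (0, 8)),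
      ((-4, 0), (0, 8)), ((-4, 0), (-8, -8)), ((0, -4), (-8, -8)),
      ((0, -4), (0, -2)), ((4, 4), (2, 2)), ((-4, 0), (-2, 0)),
      ((0, 0), (0, -2)), ((0, 0), (2, 2)), ((0, 0), (-2, 0))] @
     map fst core_crossings @ map snd core_crossings"

text \<open>The core with its centre split into \<open>(1, 0)\<close>, \<open>(0, 1)\<close> and
  \<open>(-1, -1)\<close>, which opens the hole.\<close>

definition ring_crossings :: "((ipoint \<times> ipoint) \<times> (ipoint \<times> ipoint)) list" where
  "ring_crossings =
     [(((1, 0), (8, 0)), ((4, 4), (0, -2))),
      (((0, 1), (0, 8)), ((-4, 0), (2, 2))),
      (((-1, -1), (-8, -8)), ((0, -4), (-2, 0)))]"

definition ring_edges :: "(ipoint \<times> ipoint) list" where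
  "ring_edges =
     [((0, -4), (8, 0)), ((4, 4), (8, 0)), ((4, 4), (0, 8)),
      ((-4, 0), (0, 8)), ((-4, 0), (-8, -8)), ((0, -4), (-8, -8)),
      ((0, -4), (0, -2)), ((4, 4), (2, 2)), ((-4, 0), (-2, 0))] @
     map fst ring_crossings @ map snd ring_crossings"

definition ring_hole :: "ipoint list" where
  "ring_hole = [(1, 0), (0, -2), (-1, -1), (-2, 0), (0, 1), (2, 2)]"

text \<open>
  The outer cap together with one ring: the cap alone has no straight-line drawing around a cycle drawn as
  a triangle. The coordinates are a rounded Tutte embedding of the planar graph in which each
  crossing pair is replaced by the 4-cycle through its endpoints, with outer face \<open>(0,0), (26,0), (0,26)\<close>.
\<close>

definition outer_crossings :: "((ipoint \<times> ipoint) \<times> (ipoint \<times> ipoint)) list" where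
  "outer_crossings =
     [(((12, 10), (6, 6)), ((8, 12), (12, 8))),
      (((18, 4), (6, 6)), ((10, 6), (26, 0))),
      (((0, 26), (6, 6)), ((0, 0), (6, 14))),
      (((12, 11), (6, 14)), ((12, 10), (10, 14))),
      (((16, 7), (12, 8)), ((18, 4), (14, 8))),
      (((14, 10), (26, 0)), ((0, 26), (18, 6)))]"

text \<open>The cap vertex is \<open>(6, 6)\<close>, joined through \<open>(8, 12)\<close>,
  \<open>(10, 6)\<close> and \<open>(0, 0)\<close> to the cycle \<open>(0, 26)\<close>,
  \<open>(6, 14)\<close>, \<open>(12, 10)\<close>, \<open>(12, 8)\<close>, \<open>(18, 4)\<close>,
  \<open>(26, 0)\<close>. The three edges to the hole start at \<open>(0, 26)\<close>,
  \<open>(12, 10)\<close> and \<open>(18, 4)\<close>.\<close>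

definition outer_edges :: "(ipoint \<times> ipoint) list" where
  "outer_edges =
     [((8, 12), (6, 14)), ((10, 6), (12, 8)), ((0, 0), (26, 0)),
      ((8, 12), (6, 6)), ((10, 6), (6, 6)), ((0, 0), (6, 6)),
      ((0, 26), (6, 14)), ((12, 10), (6, 14)), ((12, 10), (12, 8)),
      ((18, 4), (12, 8)), ((18, 4), (26, 0)), ((0, 26), (26, 0)),
      ((0, 26), (10, 14)), ((12, 10), (14, 8)), ((18, 4), (18, 6))] @
     map fst outer_crossings @ map snd outer_crossings"

definition outer_hole :: "ipoint list" where
  "outer_hole = [(12, 11), (10, 14), (14, 10), (18, 6), (16, 7), (14, 8)]"

section \<open>Evaluation of the certificates\<close>

lemma core_patch_check: "patch_check core_edges core_crossings"
  by code_simp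

lemma ring_patch_check: "patch_check ring_edges ring_crossings"
  by code_simp

lemma ring_frame_check: "frame_check ring_edges ring_crossings ring_hole"
  by code_simp

lemma ring_hole_inside: "list_all (beyond (corners ring_hole)) base_hexagon"
  by code_simp

lemma outer_frame_check: "frame_check outer_edges outer_crossings outer_hole"
  by code_simp

lemma card_edges: "card (set core_edges) = 18" "card (set ring_edges) = 15" "card (set outer_edges) = 27"
  by code_simp+

lemma card_points:
  "card (set (map fst core_edges @ map snd core_edges)) = 10"
  "card (set (map fst ring_edges @ map snd ring_edges)) = 12"
  "card (set (map fst outer_edges @ map snd outer_edges)) = 16"
  by code_simp+

text \<open>A contraction that reverses orientation. On both its cycles a ring uses the sides
  running clockwise from the even vertices, so the reflected copy inside uses the complementary
  sides of the shared cycle.\<close>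

definition ring_map :: "complex \<Rightarrow> complex" where
  "ring_map = affine_map 0 (-1/4) (-1/4) 0 0"

text \<open>Determined by the images of the three corners; the even vertices follow, being midpoints
  of the triangle sides in both hexagons.\<close>

definition outer_map :: "complex \<Rightarrow> complex" where
  "outer_map = affine_map (-1/2) (1/2) (7/12) (-5/12) (Complex 14 (28/3))"

lemma ring_map_hole: "i < 6 \<Longrightarrow> ring_map (pt (base_hexagon ! i)) = pt (ring_hole ! i)"
  by (auto simp: numeral_eq_Suc less_Suc_eq ring_map_def affine_map_def base_hexagon_def ring_hole_def pt_def complex_eq_iff)

lemma outer_map_hole: "i < 6 \<Longrightarrow> outer_map (pt (base_hexagon ! i)) = pt (outer_hole ! i)"
  by (auto simp: numeral_eq_Suc less_Suc_eq outer_map_def affine_map_def base_hexagon_def outer_hole_def pt_def complex_eq_iff)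

section \<open>The nested drawings and their sizes\<close>

primrec nested :: "nat \<Rightarrow> (complex \<times> complex) set" where
  "nested 0 = iedge ` set core_edges"
| "nested (Suc k) = iedge ` set ring_edges \<union> map_prod ring_map ring_map ` nested k"

lemma patch_nested: "patch (nested k)"
proof (induction k)
  case 0
  show ?case using patch_check_sound[OF core_patch_check] by simp
next
  case (Suc k)
  show ?case
    unfolding nested.simps
    by (rule frame_patch_patch[OF ring_frame_check ring_patch_check ring_hole_inside Suc _
          ring_map_def ring_map_hole]) simp_all
qed

text \<open>Each ring adds 6 vertices and 15 edges, the exact ratio 2.5. The core falls two edges
  short of \<open>2.5 * 10 - 5\<close>, since its unbounded face has no diagonals; the outer frame
  makes up for them with 27 edges on 10 further vertices.\<close>

lemma card_nested: "card (nested k) = 18 + 15 * k" "card (verts (nested k)) = 10 + 6 * k"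
proof (induction k)
  case 0
  have "inj_on iedge A" "inj_on pt B" for A B by (auto simp: inj_on_def)
  then show "card (nested 0) = 18 + 15 * 0" "card (verts (nested 0)) = 10 + 6 * 0"
    using card_edges(1) card_points(1) by (simp_all only: nested.simps verts_iedge card_image)
next
  case (Suc k)
  note frame = frame_patch[OF ring_frame_check patch_nested[of k] _ ring_map_def ring_map_hole]
  show "card (nested (Suc k)) = 18 + 15 * Suc k"
    unfolding nested.simps using frame(2) Suc card_edges(2) by simp
  show "card (verts (nested (Suc k))) = 10 + 6 * Suc k"
    unfolding nested.simps using frame(3) Suc card_points(2) by simp
qed

definition family :: "nat \<Rightarrow> (complex \<times> complex) set" where
  "family k = iedge ` set outer_edges \<union> map_prod outer_map outer_map ` nested k"

lemma nic_segments_family: "nic_segments (family k)"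
  unfolding family_def
  by (rule frame_patch(1)[OF outer_frame_check patch_nested _ outer_map_def outer_map_hole]) simp_all

lemma card_family: "card (family k) = 45 + 15 * k" "card (verts (family k)) = 20 + 6 * k"
proof -
  note frame = frame_patch[OF outer_frame_check patch_nested[of k] _ outer_map_def outer_map_hole]
  show "card (family k) = 45 + 15 * k"
    unfolding family_def using frame(2) card_nested card_edges(3) by simp
  show "card (verts (family k)) = 20 + 6 * k"
    unfolding family_def using frame(3) card_nested card_points(3) by simp
qed

theorem theorem3:
  "\<exists>S :: (nat set \<times> nat set set) set.
     infinite S \<and>
     pairwise (\<lambda>G H. \<not> graph_iso G H) S \<and>
     (\<forall>(V, E)\<in>S. simple_graph V E \<and> bipartite V E \<and> NIC_planar V E \<and>
        real (card E) = 2.5 * real (card V) - 5)"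
proof -
  \<comment> \<open>The finitely many points of the drawing are renamed to natural numbers.\<close>
  define h where "h k = to_nat_on (verts (family k))" for k
  define G where "G k = (h k ` verts (family k), (\<lambda>e. h k ` ends e) ` family k)" for k
  have "inj_on (h k) (verts (family k))" for k
  proof -
    have "finite (verts (family k))"
      using nic_segments_family[of k] by (auto simp: nic_segments_def verts_def)
    then show ?thesis
      unfolding h_def by (intro inj_on_to_nat_on countable_finite)
  qed
  note graph = nic_segments_graph[OF nic_segments_family this]
  have card_V: "card (fst (G k)) = 20 + 6 * k" and card_E: "card (snd (G k)) = 45 + 15 * k" for k
    using graph(4,5)[of k] card_family by (simp_all add: G_def)
  \<comment> \<open>The number of vertices alone distinguishes the members of the family.\<close>
  have iso_eq: "k = l" if "graph_iso (G k) (G l)" for k l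
  proof -
    have "card (fst (G k)) = card (fst (G l))"
      using that bij_betw_same_card unfolding graph_iso_def by blast
    then show ?thesis by (simp add: card_V)
  qed
  have "inj G"
    using card_V by (metis add_left_cancel injI mult_left_cancel zero_neq_numeral)
  then have "infinite (range G)" by (simp add: range_inj_infinite)
  moreover have "pairwise (\<lambda>G H. \<not> graph_iso G H) (range G)"
    using iso_eq by (auto simp: pairwise_def)
  moreover have "simple_graph V E \<and> bipartite V E \<and> NIC_planar V E \<and>
      real (card E) = 2.5 * real (card V) - 5" if VE: "G k = (V, E)" for V E k
  proof -
    have "card V = 20 + 6 * k" "card E = 45 + 15 * k"
      using card_V[of k] card_E[of k] by (simp_all add: VE)
    moreover have "simple_graph V E" "bipartite V E" "NIC_planar V E"
      using VE graph(1-3)[of k] by (simp_all add: G_def)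
    ultimately show ?thesis by simp
  qed
  ultimately show ?thesis by (intro exI[of _ "range G"]) auto
qed

end
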